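(* Let $F(x)=x^6+ax+b\in\mathbb{Z}[x]$ be irreducible over $\mathbb{Q}$ and let $K=\mathbb{Q}(\theta)$, where $\theta$ is a complex root of $F(x)$. If one of the following conditions holds: (1) $a \equiv 0 \pmod 8$ and $b \equiv 7 \pmod 8$; (2) $a\equiv 2 \pmod 4$, $b \equiv 1 \pmod 4$ and $\nu_2(1+a+b) = 2 \nu_2(a+6)$ (in particular, if $(\overline{a},\overline{b})= ( \overline{6}, \overline{9})$, $(\overline{14}, \bar{1})$, $( \overline{22}, \overline{25})$ or $(\overline{30}, \overline{17})$ in $(\mathbb{Z}/64\mathbb{Z})^2$); (3) $a \equiv 0 \pmod 8$ and $b \equiv 3 \pmod 8$; (4) $a\equiv 0 \pmod 9$ and $b \equiv -1 \pmod 9$; then $K$ is not monogenic.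
   Context: $\nu_2(t)$ is the $2$-adic valuation of the integer $t$ (with $\nu_2(0)=\infty$). $\bar t$ denotes the residue class of the integer $t$ in the indicated ring $\mathbb{Z}/N\mathbb{Z}$. $\mathbb{Z}_K$ denotes the ring of integers of $K$. $K$ is called monogenic if $\mathbb{Z}_K=\mathbb{Z}[\eta]$ for some $\eta\in\mathbb{Z}_K$ with $K=\mathbb{Q}(\eta)$; otherwise $K$ is not monogenic. *)

theory Defs
  imports
    "HOL-Algebra.Algebraic_Closure_Type"
    "HOL-Algebra.Generated_Fields"
    "HOL-Algebra.Generated_Rings"
    "HOL-Number_Theory.Cong"
    "HOL-Library.Extended_Nat"
begin

(* multiplicity 2 0 = 0 in the library, whereas nu_2(0) is infinite. *)
definition nu2 :: "int \<Rightarrow> enat" where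
  "nu2 t = (if t = 0 then \<infinity> else enat (multiplicity 2 t))"

abbreviation complex_ring :: "complex ring" where
  "complex_ring \<equiv> ring_of_type_algebra"

(* Q(x): every subfield of the complex numbers contains Q, so x is the only generator needed. *)
definition rat_adjoin :: "complex \<Rightarrow> complex set" where
  "rat_adjoin x = generate_field complex_ring {x}"

(* Z[x]: likewise, every (unital) subring contains Z. *)
definition int_adjoin :: "complex \<Rightarrow> complex set" where
  "int_adjoin x = generate_ring complex_ring {x}"

definition ring_of_integers :: "complex set \<Rightarrow> complex set" where
  "ring_of_integers K = {x \<in> K. algebraic_int x}"

definition monogenic :: "complex set \<Rightarrow> bool" where
  "monogenic K \<longleftrightarrow>
     (\<exists>\<eta> \<in> ring_of_integers K. K = rat_adjoin \<eta> \<and> ring_of_integers K = int_adjoin \<eta>)"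

end

theory Submission
  imports Defs "Jordan_Normal_Form.Char_Poly"
begin

text \<open>
  Put \<open>p = 3\<close> under condition (4) and \<open>p = 2\<close> otherwise. In each case there is an explicit integral
  \<open>\<alpha>\<close> such that the order \<open>A = \<int>[\<theta>] + \<alpha> \<int>[\<theta>]\<close>, of rank 6, is maximal at \<open>p\<close>; let \<open>N\<close> be the
  radical of \<open>p A\<close>. If the ring of integers were \<open>\<int>[\<eta>]\<close>, then \<open>A / N\<close> would be generated by one
  element as an algebra over \<open>\<int> / p\<close>, so this element would not be a root of any monic polynomial
  of degree less than \<open>dim (A / N)\<close>. However,

  \<^item> in (1) and (3), \<open>A / N = A / 2\<close> has dimension 6 and \<open>y\<^sup>4 = y\<close> holds identically;
  \<^item> in (2), \<open>A / N\<close> is \<open>F\<^sub>4 \<times> F\<^sub>4\<close>, of dimension 4, and each \<open>y\<close> satisfies a cubic equation;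
  \<^item> in (4), \<open>A / N\<close> is \<open>F\<^sub>3\<^sup>4\<close>, of dimension 4, and \<open>y\<^sup>3 = y\<close> holds identically.
\<close>

section \<open>Integral spans\<close>

text \<open>Primes other than \<open>p\<close> may divide the index of \<open>A\<close>, so
  \<open>A\<close> is compared with the integers only up to factors prime to \<open>p\<close>; such
  multiples take the place of localisation. The obstruction is a shortage of irreducible polynomials
  over the prime field. F_2 has one irreducible quadratic, but two or three factors F_4 occur; F_3
  has three monic linear polynomials, but four factors F_3 occur. The element \<alpha> comes from
  reducing the polynomial: F is (x^3 - 1)^2 mod 2 in (1) and (3), F(x + 1) is (x^3 + x^2 + x)^2 mod
  2 in (2), and F is (x^2 - 1)^3 mod 3 in (4). In (1) and (3), adjoining \<alpha> makes
  \<open>A / p A\<close> reduced. In (2) and (4) some ramification remains, so \<open>N\<close>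
  needs a second generator \<open>w\<close>, which lifts the base of the displayed power. The
  identity y^4 = y also holds in case (2), but its degree 4 is not below the dimension 4; hence the
  separate treatment by cubics.\<close>

definition int_span :: "nat \<Rightarrow> (nat \<Rightarrow> complex) \<Rightarrow> complex set" where
  "int_span n e = {\<Sum>i<n. of_int (c i) * e i | c. True}"

lemma int_span_base: "i < n \<Longrightarrow> e i \<in> int_span n e"
  unfolding int_span_def
  by (auto intro!: exI[of _ "\<lambda>j. if j = i then 1 else 0"] simp: if_distrib if_distribR cong: if_cong)

lemma int_span_0: "0 \<in> int_span n e"
  unfolding int_span_def by (auto intro!: exI[of _ "\<lambda>_. 0"])

lemma int_span_add: "x \<in> int_span n e \<Longrightarrow> y \<in> int_span n e \<Longrightarrow> x + y \<in> int_span n e"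
  unfolding int_span_def
proof safe
  fix c d :: "nat \<Rightarrow> int"
  show "\<exists>k. (\<Sum>i<n. of_int (c i) * e i) + (\<Sum>i<n. of_int (d i) * e i) = (\<Sum>i<n. of_int (k i) * e i) \<and> True"
    by (intro exI[of _ "\<lambda>i. c i + d i"]) (simp add: sum.distrib ring_distribs)
qed

lemma int_span_scale: "x \<in> int_span n e \<Longrightarrow> of_int k * x \<in> int_span n e"
  unfolding int_span_def
proof safe
  fix c :: "nat \<Rightarrow> int"
  show "\<exists>d. of_int k * (\<Sum>i<n. of_int (c i) * e i) = (\<Sum>i<n. of_int (d i) * e i) \<and> True"
    by (intro exI[of _ "\<lambda>i. k * c i"]) (simp add: sum_distrib_left mult.assoc)
qed

lemma int_span_uminus: "x \<in> int_span n e \<Longrightarrow> - x \<in> int_span n e"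
  using int_span_scale[of x n e "-1"] by simp

lemma int_span_diff: "x \<in> int_span n e \<Longrightarrow> y \<in> int_span n e \<Longrightarrow> x - y \<in> int_span n e"
  using int_span_add[of x n e "- y"] int_span_uminus[of y] by simp

lemma int_span_numeral: "x \<in> int_span n e \<Longrightarrow> numeral k * x \<in> int_span n e"
  using int_span_scale[of x n e "numeral k"] by simp

lemmas int_span_intros = int_span_0 int_span_add int_span_scale int_span_uminus int_span_diff int_span_numeral

lemma int_span_sum: "(\<And>i. i \<in> I \<Longrightarrow> f i \<in> int_span n e) \<Longrightarrow> sum f I \<in> int_span n e"
  by (induction I rule: infinite_finite_induct) (auto intro: int_span_intros)

text \<open>Source and target lattice may differ: besides closure under multiplication, this yields
  inclusions of multiples of a lattice in a smaller one.\<close>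

lemma int_span_mult_left:
  assumes "\<And>i. i < n \<Longrightarrow> x * e i \<in> int_span m f" and "y \<in> int_span n e"
  shows "x * y \<in> int_span m f"
proof -
  from assms(2) obtain c where c: "y = (\<Sum>i<n. of_int (c i) * e i)"
    by (auto simp: int_span_def)
  have "x * y = (\<Sum>i<n. of_int (c i) * (x * e i))"
    by (simp add: c sum_distrib_left mult_ac)
  then show ?thesis
    using assms(1) by (auto intro!: int_span_sum int_span_scale)
qed

text \<open>Cayley--Hamilton: multiplication by \<open>x\<close> is an integer matrix, and \<open>e\<close> is an eigenvector of it.\<close>

lemma algebraic_int_int_span:
  assumes stable: "\<And>i. i < n \<Longrightarrow> x * e i \<in> int_span n e"
    and nz: "i0 < n" "e i0 \<noteq> 0"
  shows "algebraic_int x"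
proof -
  have "\<forall>i. \<exists>c. i < n \<longrightarrow> x * e i = (\<Sum>j<n. complex_of_int (c j) * e j)"
    using stable by (force simp: int_span_def)
  then obtain c where c: "\<And>i. i < n \<Longrightarrow> x * e i = (\<Sum>j<n. complex_of_int (c i j) * e j)"
    by metis
  define M where "M = Matrix.mat n n (\<lambda>(i, j). c i j)"
  have M: "M \<in> carrier_mat n n" by (simp add: M_def)
  let ?M = "map_mat complex_of_int M"
  define v where "v = Matrix.vec n e"
  have Mv: "?M *\<^sub>v v = x \<cdot>\<^sub>v v"
    by (rule eq_vecI) (auto simp: M_def v_def scalar_prod_def c atLeast0LessThan)
  have "v \<noteq> 0\<^sub>v n"
    using nz by (auto simp: v_def vec_eq_iff)
  with Mv M have "eigenvalue ?M x"
    unfolding eigenvalue_def eigenvector_def by (auto intro!: exI[of _ v] simp: v_def)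
  then have "poly (char_poly ?M) x = 0"
    using eigenvalue_root_char_poly[of ?M n x] M by simp
  moreover have "char_poly ?M = of_int_poly (char_poly M)"
    by (rule of_int_hom.char_poly_hom[OF M])
  moreover have "lead_coeff (char_poly M) = 1"
    using degree_monic_char_poly[OF M] by simp
  ultimately show ?thesis
    unfolding algebraic_int_altdef_ipoly by (auto intro!: exI[of _ "char_poly M"])
qed

section \<open>Simple extensions\<close>

lemma complex_ring_ops [simp]:
  "\<one>\<^bsub>complex_ring\<^esub> = 1" "\<zero>\<^bsub>complex_ring\<^esub> = 0"
  "x \<oplus>\<^bsub>complex_ring\<^esub> y = x + y" "x \<otimes>\<^bsub>complex_ring\<^esub> y = x * y"
  "carrier complex_ring = UNIV"
  by (simp_all add: ring_of_type_algebra_def)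

lemma complex_ring_inverses [simp]:
  "\<ominus>\<^bsub>complex_ring\<^esub> x = - x" "x \<noteq> 0 \<Longrightarrow> inv\<^bsub>complex_ring\<^esub> x = inverse x"
proof -
  interpret R: field complex_ring ..
  show "\<ominus>\<^bsub>complex_ring\<^esub> x = - x"
    by (rule R.minus_equality) auto
  show "inv\<^bsub>complex_ring\<^esub> x = inverse x" if "x \<noteq> 0"
    by (rule R.comm_inv_char) (use that in auto)
qed

text \<open>A bare predicate on sets, so that Z[\<eta>], Q(\<theta>), the explicit order and the set
  of solutions of y^q = y modulo an ideal are all handled by the same closure rules.\<close>

definition subring_set :: "complex set \<Rightarrow> bool" where
  "subring_set B \<longleftrightarrow> 1 \<in> B \<and> (\<forall>x\<in>B. \<forall>y\<in>B. x - y \<in> B \<and> x * y \<in> B)"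

context
  fixes B assumes B: "subring_set B"
begin

lemma subring_set_1: "1 \<in> B" using B by (simp add: subring_set_def)

lemma subring_set_diff: "x \<in> B \<Longrightarrow> y \<in> B \<Longrightarrow> x - y \<in> B"
  using B by (simp add: subring_set_def)

lemma subring_set_mult: "x \<in> B \<Longrightarrow> y \<in> B \<Longrightarrow> x * y \<in> B"
  using B by (simp add: subring_set_def)

lemma subring_set_0: "0 \<in> B"
  using subring_set_diff[OF subring_set_1 subring_set_1] by simp

lemma subring_set_uminus: "x \<in> B \<Longrightarrow> - x \<in> B"
  using subring_set_diff[OF subring_set_0] by simp

lemma subring_set_add: "x \<in> B \<Longrightarrow> y \<in> B \<Longrightarrow> x + y \<in> B"
  using subring_set_diff[of x "- y"] subring_set_uminus[of y] by simp

lemma subring_set_of_nat: "of_nat n \<in> B"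
  by (induction n) (auto intro: subring_set_0 subring_set_1 subring_set_add)

lemma subring_set_of_int: "of_int k \<in> B"
  by (cases k rule: int_cases2) (auto intro: subring_set_of_nat subring_set_uminus)

lemma subring_set_numeral: "numeral k \<in> B"
  using subring_set_of_int[of "numeral k"] by simp

lemma subring_set_power: "x \<in> B \<Longrightarrow> x ^ n \<in> B"
  by (induction n) (auto intro: subring_set_1 subring_set_mult)

lemma subring_set_sum: "(\<And>i. i \<in> I \<Longrightarrow> f i \<in> B) \<Longrightarrow> sum f I \<in> B"
  by (induction I rule: infinite_finite_induct) (auto intro: subring_set_0 subring_set_add)

lemmas subring_set_closed = subring_set_0 subring_set_1 subring_set_diff subring_set_mult
  subring_set_uminus subring_set_add subring_set_of_int subring_set_numeral subring_set_power

lemma subring_set_poly: "x \<in> B \<Longrightarrow> poly (of_int_poly h) x \<in> B"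
  by (induction h) (auto intro: subring_set_closed)

lemma int_span_subset_subring: "(\<And>i. i < n \<Longrightarrow> e i \<in> B) \<Longrightarrow> int_span n e \<subseteq> B"
  by (auto simp: int_span_def intro!: subring_set_sum subring_set_mult subring_set_of_int)

end

lemma subring_set_polys: "subring_set {poly (of_int_poly h) x | h. True}"
  unfolding subring_set_def
proof (safe)
  show "\<exists>h. 1 = poly (of_int_poly h) x \<and> True" by (intro exI[of _ 1]) simp
next
  fix p q
  show "\<exists>h. poly (of_int_poly p) x - poly (of_int_poly q) x = poly (of_int_poly h) x \<and> True"
    by (intro exI[of _ "p - q"]) (simp add: of_int_poly_hom.hom_minus)
  show "\<exists>h. poly (of_int_poly p) x * poly (of_int_poly q) x = poly (of_int_poly h) x \<and> True"
    by (intro exI[of _ "p * q"]) (simp add: of_int_poly_hom.hom_mult)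
qed

lemma subring_set_int_adjoin: "subring_set (int_adjoin x)"
  using generate_ring.intros[where R = complex_ring and H = "{x}"]
  unfolding subring_set_def int_adjoin_def
  by (force simp: diff_conv_add_uminus simp del: add_uminus_conv_diff)

lemma int_adjoin_eq_polys: "int_adjoin x = {poly (of_int_poly h) x | h. True}"
proof (intro equalityI subsetI)
  fix z assume "z \<in> int_adjoin x"
  then show "z \<in> {poly (of_int_poly h) x | h. True}"
    unfolding int_adjoin_def
  proof (induction rule: generate_ring.induct)
    case (incl h)
    then show ?case by (auto intro!: exI[of _ "[:0, 1:]"])
  qed (use subring_set_closed[OF subring_set_polys[of x]] in simp_all)
next
  have "x \<in> int_adjoin x"
    unfolding int_adjoin_def by (rule generate_ring.incl) simp
  then show "z \<in> int_adjoin x" if "z \<in> {poly (of_int_poly h) x | h. True}" for z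
    using that subring_set_poly[OF subring_set_int_adjoin] by auto
qed

lemma subring_set_rat_adjoin: "subring_set (rat_adjoin x)"
  using generate_field.intros[where R = complex_ring and H = "{x}"]
  unfolding subring_set_def rat_adjoin_def
  by (force simp: diff_conv_add_uminus simp del: add_uminus_conv_diff)

lemma rat_adjoin_self: "x \<in> rat_adjoin x"
  unfolding rat_adjoin_def by (rule generate_field.incl) simp

lemma rat_adjoin_inverse: "z \<in> rat_adjoin x \<Longrightarrow> inverse z \<in> rat_adjoin x"
  using generate_field.m_inv[of z complex_ring "{x}"] subring_set_0[OF subring_set_rat_adjoin[of x]]
  unfolding rat_adjoin_def by (cases "z = 0") auto

lemma rat_adjoin_divide: "z \<in> rat_adjoin x \<Longrightarrow> y \<in> rat_adjoin x \<Longrightarrow> z / y \<in> rat_adjoin x"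
  using subring_set_mult[OF subring_set_rat_adjoin] rat_adjoin_inverse by (simp add: divide_inverse)

section \<open>Elements of Q(x) as integer polynomials in x over an integer denominator\<close>

lemma clear_denominators:
  fixes q :: "rat poly"
  shows "\<exists>d h. d \<noteq> (0 :: int) \<and> smult (of_int d) q = of_int_poly h"
proof (induction q)
  case 0
  show ?case by (rule exI[of _ 1], rule exI[of _ 0]) simp
next
  case (pCons a q)
  then obtain d h where dh: "d \<noteq> 0" "smult (of_int d) q = of_int_poly h" by blast
  obtain s t where st: "quotient_of a = (s, t)" by (cases "quotient_of a") auto
  then have "t > 0" "a = of_int s / of_int t"
    by (auto intro: quotient_of_denom_pos quotient_of_div)
  then have "of_int (d * t) * a = rat_of_int (d * s)"
    by simp
  moreover have "smult (of_int (d * t)) q = of_int_poly (smult t h)"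
    by (simp add: dh(2)[symmetric] of_int_hom.map_poly_hom_smult mult.commute)
  ultimately have "smult (of_int (d * t)) (pCons a q) = of_int_poly (pCons (d * s) (smult t h))"
    by (simp only: smult_pCons of_int_hom.map_poly_pCons_hom)
  then show ?case using dh \<open>t > 0\<close> by (metis mult_eq_0_iff less_irrefl)
qed

context
  fixes F :: "int poly" and x :: complex
  assumes irr: "Factorial_Ring.irreducible (map_poly rat_of_int F)"
    and root: "poly (of_int_poly F) x = 0"
begin

text \<open>Since h(x) is nonzero, F does not divide h, so the two are coprime over Q. Evaluating a
  Bezout identity s h + t F = 1 at x inverts h(x); the integer \<open>c\<close> is the denominator
  cleared from s.\<close>

lemma coprime_nonvanishing:
  assumes "poly (of_int_poly h) x \<noteq> 0"
  shows "\<exists>k c. c \<noteq> (0 :: int) \<and> poly (of_int_poly h) x * poly (of_int_poly k) x = of_int c"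
proof -
  let ?F = "map_poly rat_of_int F" and ?h = "map_poly rat_of_int h"
  interpret rh: map_poly_comm_ring_hom "of_rat :: rat \<Rightarrow> complex" ..
  have ev: "poly (map_poly of_rat (map_poly rat_of_int q)) x = poly (of_int_poly q) x" for q
    by (simp add: map_poly_map_poly o_def)
  have "\<not> ?F dvd ?h"
  proof
    assume "?F dvd ?h"
    then obtain q where "?h = ?F * q" by (elim dvdE)
    then have "poly (map_poly of_rat ?h) x = poly (map_poly of_rat ?F) x * poly (map_poly of_rat q) x"
      by (simp add: rh.hom_mult)
    with assms root ev show False by simp
  qed
  then have "coprime ?h ?F"
    using irr prime_elem_imp_coprime[of ?F ?h] by (simp add: coprime_commute prime_elem_iff_irreducible)
  then obtain s t where st: "s * ?h + t * ?F = 1"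
    using bezout_coefficients_fst_snd[of ?h ?F] by (metis coprime_iff_gcd_eq_1)
  obtain d k where dk: "d \<noteq> 0" "smult (of_int d) s = of_int_poly k"
    using clear_denominators by blast
  have "poly (map_poly of_rat s) x * poly (of_int_poly h) x = 1"
    using arg_cong[OF st, of "\<lambda>p. poly (map_poly of_rat p) x"] root
    by (simp add: rh.hom_mult rh.hom_add ev)
  moreover have "poly (of_int_poly k) x = of_int d * poly (map_poly of_rat s) x"
    unfolding ev[symmetric] dk(2)[symmetric] by (simp add: of_rat_hom.map_poly_hom_smult)
  ultimately show ?thesis
    using dk(1) by (intro exI[of _ k] exI[of _ d]) (simp add: mult_ac)
qed

text \<open>This is Q(x) = Q[x] for algebraic x. Among the closure steps only inversion needs F,
  through the preceding Bezout argument.\<close>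

lemma rat_adjoin_common_denominator:
  assumes "z \<in> rat_adjoin x"
  shows "\<exists>d h. d \<noteq> (0 :: int) \<and> of_int d * z = poly (of_int_poly h) x"
  using assms unfolding rat_adjoin_def
proof (induction rule: generate_field.induct)
  case one
  show ?case by (auto intro!: exI[of _ 1])
next
  case (incl h)
  then show ?case by (auto intro!: exI[of _ 1] exI[of _ "[:0, 1:]"])
next
  case (a_inv h)
  then obtain d p where "d \<noteq> 0" "of_int d * h = poly (of_int_poly p) x" by auto
  then show ?case by (intro exI[of _ "- d"] exI[of _ p]) auto
next
  case (m_inv h)
  then obtain d p where dp: "d \<noteq> 0" "of_int d * h = poly (of_int_poly p) x" by auto
  with m_inv have "poly (of_int_poly p) x \<noteq> 0" by auto
  from coprime_nonvanishing[OF this] obtain k c where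
    "c \<noteq> 0" "poly (of_int_poly p) x * poly (of_int_poly k) x = of_int c" by blast
  with dp m_inv show ?case
    by (intro exI[of _ c] exI[of _ "smult d k"])
      (auto simp: of_int_hom.map_poly_hom_smult field_simps simp flip: dp(2))
next
  case (eng_add h1 h2)
  then obtain d1 p1 d2 p2 where *: "d1 \<noteq> 0" "of_int d1 * h1 = poly (of_int_poly p1) x"
    "d2 \<noteq> 0" "of_int d2 * h2 = poly (of_int_poly p2) x" by auto
  have "of_int (d1 * d2) * (h1 + h2) = of_int d2 * (of_int d1 * h1) + of_int d1 * (of_int d2 * h2)"
    by (simp add: algebra_simps)
  with * show ?case
    by (intro exI[of _ "d1 * d2"] exI[of _ "smult d2 p1 + smult d1 p2"])
      (simp add: of_int_hom.map_poly_hom_smult of_int_poly_hom.hom_add)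
next
  case (eng_mult h1 h2)
  then obtain d1 p1 d2 p2 where *: "d1 \<noteq> 0" "of_int d1 * h1 = poly (of_int_poly p1) x"
    "d2 \<noteq> 0" "of_int d2 * h2 = poly (of_int_poly p2) x" by auto
  have "of_int (d1 * d2) * (h1 * h2) = (of_int d1 * h1) * (of_int d2 * h2)"
    by (simp add: algebra_simps)
  with * show ?case
    by (intro exI[of _ "d1 * d2"] exI[of _ "p1 * p2"]) (simp add: of_int_poly_hom.hom_mult)
qed

text \<open>F is the minimal polynomial of x up to a scalar.\<close>

lemma degree_le_vanishing:
  assumes "poly (of_int_poly h) x = 0" "h \<noteq> 0"
  shows "Polynomial.degree F \<le> Polynomial.degree h"
proof -
  let ?F = "map_poly rat_of_int F" and ?h = "map_poly rat_of_int h"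
  interpret rh: map_poly_comm_ring_hom "of_rat :: rat \<Rightarrow> complex" ..
  have ev: "poly (map_poly of_rat (map_poly rat_of_int q)) x = poly (of_int_poly q) x" for q
    by (simp add: map_poly_map_poly o_def)
  have "?F dvd ?h"
  proof (rule ccontr)
    assume "\<not> ?F dvd ?h"
    then have "coprime ?h ?F"
      using irr prime_elem_imp_coprime[of ?F ?h] by (simp add: coprime_commute prime_elem_iff_irreducible)
    then obtain s t where st: "s * ?h + t * ?F = 1"
      using bezout_coefficients_fst_snd[of ?h ?F] by (metis coprime_iff_gcd_eq_1)
    show False
      using arg_cong[OF st, of "\<lambda>p. poly (map_poly of_rat p) x"] root assms
      by (simp add: rh.hom_mult rh.hom_add ev)
  qed
  then have "Polynomial.degree ?F \<le> Polynomial.degree ?h"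
    by (rule dvd_imp_degree_le) (use assms in auto)
  then show ?thesis by simp
qed

end

section \<open>A pigeonhole argument modulo a subgroup\<close>

text \<open>Counting replaces linear algebra over Z/p: there are p^d coefficient vectors with
  entries below p, but only p^r vectors of coordinates modulo p with respect to \<open>w\<close>.
  Two coefficient vectors collide, and some entry of their difference is nonzero of absolute value
  below p.\<close>

lemma dependence_mod:
  fixes p :: int and v w :: "nat \<Rightarrow> complex"
  assumes p: "p > 1" and "r < d"
    and J: "\<And>x y. x \<in> J \<Longrightarrow> y \<in> J \<Longrightarrow> x + y \<in> J" "\<And>x k. x \<in> J \<Longrightarrow> of_int k * x \<in> J" "0 \<in> J"
    and pw: "\<And>j. j < r \<Longrightarrow> of_int p * w j \<in> J"
    and v: "\<And>i. i < d \<Longrightarrow> v i - (\<Sum>j<r. of_int (m i j) * w j) \<in> J"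
  shows "\<exists>c i. i < d \<and> \<not> p dvd c i \<and> (\<Sum>i<d. of_int (c i) * v i) \<in> J"
proof -
  have J_sum: "sum f I \<in> J" if "\<And>i. i \<in> I \<Longrightarrow> f i \<in> J" for I :: "nat set" and f
    using that by (induction I rule: infinite_finite_induct) (auto intro: J)
  let ?C = "PiE {..<d} (\<lambda>_. {0..<p})" and ?R = "PiE {..<r} (\<lambda>_. {0..<p})"
  define \<phi> where "\<phi> c = (\<lambda>j\<in>{..<r}. (\<Sum>i<d. c i * m i j) mod p)" for c :: "nat \<Rightarrow> int"
  have "card ?R = nat p ^ r" "card ?C = nat p ^ d" "finite ?R"
    by (auto simp: card_PiE intro: finite_PiE)
  moreover have "nat p ^ r < nat p ^ d"
    using p \<open>r < d\<close> by (intro power_strict_increasing) auto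
  moreover have "\<phi> c \<in> ?R" for c
    using p by (simp add: \<phi>_def restrict_PiE_iff)
  then have "\<phi> ` ?C \<subseteq> ?R" by blast
  ultimately have "\<not> inj_on \<phi> ?C"
    using card_inj_on_le[of \<phi> ?C ?R] by linarith
  then obtain a b where ab: "a \<in> ?C" "b \<in> ?C" "\<phi> a = \<phi> b" "a \<noteq> b"
    unfolding inj_on_def by blast
  define c where "c i = a i - b i" for i
  obtain i where i: "a i \<noteq> b i" using ab(4) by (meson ext)
  have "i < d" using i ab(1,2) by (metis PiE_arb lessThan_iff)
  then have "a i \<in> {0..<p}" "b i \<in> {0..<p}" using ab(1,2) PiE_mem by blast+
  then have "\<not> p dvd c i"
    using i zdvd_not_zless[of "c i" p] zdvd_not_zless[of "- c i" p] dvd_diff_commute[of p "a i" "b i"]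
    unfolding c_def
    by (cases "a i" "b i" rule: linorder_cases) auto
  have "p dvd (\<Sum>i<d. c i * m i j)" if "j < r" for j
  proof -
    have "(\<Sum>i<d. a i * m i j) mod p = (\<Sum>i<d. b i * m i j) mod p"
      using fun_cong[OF ab(3), of j] that by (simp add: \<phi>_def)
    then show ?thesis
      by (simp add: c_def left_diff_distrib sum_subtractf mod_eq_dvd_iff)
  qed
  note dvd = this
  define q where "q j = (\<Sum>i<d. c i * m i j) div p" for j
  have q: "(\<Sum>i<d. c i * m i j) = p * q j" if "j < r" for j
    using dvd[OF that] by (simp add: q_def)
  have "(\<Sum>i<d. of_int (c i) * v i)
      = (\<Sum>i<d. of_int (c i) * (v i - (\<Sum>j<r. of_int (m i j) * w j)))
        + (\<Sum>i<d. \<Sum>j<r. of_int (c i * m i j) * w j)"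
    by (simp add: right_diff_distrib sum_subtractf sum_distrib_left mult.assoc)
  also have "(\<Sum>i<d. \<Sum>j<r. of_int (c i * m i j) * w j) = (\<Sum>j<r. of_int (q j) * (of_int p * w j))"
  proof (subst sum.swap, rule sum.cong[OF refl])
    fix j assume "j \<in> {..<r}"
    have "(\<Sum>i<d. of_int (c i * m i j) * w j) = of_int (\<Sum>i<d. c i * m i j) * w j"
      by (simp add: sum_distrib_right)
    also have "(\<Sum>i<d. c i * m i j) = p * q j" using q \<open>j \<in> {..<r}\<close> by simp
    finally show "(\<Sum>i<d. of_int (c i * m i j) * w j) = of_int (q j) * (of_int p * w j)"
      by (simp add: mult_ac)
  qed
  finally have "(\<Sum>i<d. of_int (c i) * v i) \<in> J"
    by (auto intro!: J(1) J_sum intro: J(2)[OF v] J(2)[OF pw])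
  then show ?thesis using \<open>i < d\<close> \<open>\<not> p dvd c i\<close> by blast
qed

section \<open>A local obstruction to monogenicity\<close>

lemma poly_congruent:
  assumes B: "subring_set B" and "x \<in> B" "s \<in> B"
  shows "\<exists>t\<in>B. poly (of_int_poly g) (x + of_int p * s) = poly (of_int_poly g) x + of_int p * t"
proof (induction g)
  case 0
  then show ?case using subring_set_0[OF B] by (intro bexI[of _ 0]) auto
next
  case (pCons a g)
  then obtain t where t: "t \<in> B"
    "poly (of_int_poly g) (x + of_int p * s) = poly (of_int_poly g) x + of_int p * t" by blast
  show ?case
    by (rule bexI[of _ "x * t + s * poly (of_int_poly g) x + of_int p * s * t"])
      (use assms t in \<open>auto simp: of_int_hom.map_poly_pCons_hom algebra_simps intro!: subring_set_closed[OF B] subring_set_poly[OF B]\<close>)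
qed

lemma monic_division:
  fixes g h :: "int poly"
  assumes "Polynomial.lead_coeff g = 1"
  shows "\<exists>q m. h = g * q + m \<and> (m = 0 \<or> Polynomial.degree m < Polynomial.degree g)"
proof -
  from assms have "g \<noteq> 0" by auto
  obtain q m where "pseudo_divmod h g = (q, m)" by (cases "pseudo_divmod h g")
  from pseudo_divmod[OF \<open>g \<noteq> 0\<close> this] assms show ?thesis by auto
qed

lemma poly_as_sum_below:
  fixes x :: complex
  assumes "m = 0 \<or> Polynomial.degree m < r"
  shows "poly (of_int_poly m) x = (\<Sum>j<r. of_int (poly.coeff m j) * x ^ j)"
proof (cases "m = 0")
  case False
  then have "Polynomial.degree m < r" using assms by simp
  have "poly (of_int_poly m) x = (\<Sum>j\<le>Polynomial.degree m. of_int (poly.coeff m j) * x ^ j)"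
    by (simp add: poly_altdef)
  also have "\<dots> = (\<Sum>j<r. of_int (poly.coeff m j) * x ^ j)"
    using \<open>Polynomial.degree m < r\<close>
    by (intro sum.mono_neutral_left) (auto simp: coeff_eq_0)
  finally show ?thesis .
qed auto

section \<open>Ideals with two generators\<close>

definition ideal_gen :: "complex set \<Rightarrow> complex \<Rightarrow> complex \<Rightarrow> complex set" where
  "ideal_gen A s t = {s * x + t * y | x y. x \<in> A \<and> y \<in> A}"

context
  fixes A and s t :: complex
  assumes A: "subring_set A"
begin

lemma ideal_gen_left: "x \<in> A \<Longrightarrow> s * x \<in> ideal_gen A s t"
  unfolding ideal_gen_def using subring_set_0[OF A] by force

lemma ideal_gen_right: "y \<in> A \<Longrightarrow> t * y \<in> ideal_gen A s t"
  unfolding ideal_gen_def using subring_set_0[OF A] by force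

lemma ideal_gen_add:
  assumes "x \<in> ideal_gen A s t" "y \<in> ideal_gen A s t"
  shows "x + y \<in> ideal_gen A s t"
proof -
  obtain a b c d where "x = s * a + t * b" "y = s * c + t * d" "a \<in> A" "b \<in> A" "c \<in> A" "d \<in> A"
    using assms unfolding ideal_gen_def by blast
  then have "x + y = s * (a + c) + t * (b + d)" "a + c \<in> A" "b + d \<in> A"
    by (auto simp: algebra_simps intro: subring_set_closed[OF A])
  then show ?thesis unfolding ideal_gen_def by blast
qed

lemma ideal_gen_mult:
  assumes "x \<in> ideal_gen A s t" "a \<in> A"
  shows "a * x \<in> ideal_gen A s t"
proof -
  obtain b c where "x = s * b + t * c" "b \<in> A" "c \<in> A"
    using assms unfolding ideal_gen_def by blast
  then have "a * x = s * (a * b) + t * (a * c)" "a * b \<in> A" "a * c \<in> A"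
    using \<open>a \<in> A\<close> by (auto simp: algebra_simps intro: subring_set_closed[OF A])
  then show ?thesis unfolding ideal_gen_def by blast
qed

lemma ideal_gen_uminus: "x \<in> ideal_gen A s t \<Longrightarrow> - x \<in> ideal_gen A s t"
  using ideal_gen_mult[of x "-1"] subring_set_closed[OF A] by simp

lemma ideal_gen_diff: "x \<in> ideal_gen A s t \<Longrightarrow> y \<in> ideal_gen A s t \<Longrightarrow> x - y \<in> ideal_gen A s t"
  using ideal_gen_add[of x "- y"] ideal_gen_uminus[of y] by simp

lemma ideal_gen_subset: "s \<in> A \<Longrightarrow> t \<in> A \<Longrightarrow> ideal_gen A s t \<subseteq> A"
  by (auto simp: ideal_gen_def intro!: subring_set_closed[OF A])

end

text \<open>Multiplying a monic integral equation of z of degree n by p^n turns it into one for y =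
  p z in which the coefficient of y^j carries the factor p^(n-j); every term below y^n is thus
  divisible by p within \<open>A\<close>.\<close>

lemma power_integral_in_span:
  assumes A: "subring_set A" and y: "y \<in> A" "y = of_int p * z" and z: "algebraic_int z"
  shows "\<exists>n. \<exists>x\<in>A. y ^ n = of_int p * x"
proof -
  obtain f :: "int poly" where f: "Polynomial.lead_coeff f = 1" "poly (of_int_poly f) z = 0"
    using z unfolding algebraic_int_altdef_ipoly by blast
  let ?n = "Polynomial.degree f"
  have "0 = of_int p ^ ?n * poly (of_int_poly f) z" using f by simp
  also have "poly (of_int_poly f) z = (\<Sum>j\<le>?n. of_int (poly.coeff f j) * z ^ j)"
    by (simp add: poly_altdef)
  also have "\<dots> = (\<Sum>j<?n. of_int (poly.coeff f j) * z ^ j) + z ^ ?n"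
    using f(1) by (simp add: lessThan_Suc_atMost[symmetric])
  finally have "y ^ ?n = - (\<Sum>j<?n. of_int p ^ ?n * (of_int (poly.coeff f j) * z ^ j))"
    by (simp add: y(2) power_mult_distrib ring_distribs sum_distrib_left eq_neg_iff_add_eq_0 add.commute)
  also have "\<dots> = of_int p * (- (\<Sum>j<?n. of_int p ^ (?n - 1 - j) * (of_int (poly.coeff f j) * y ^ j)))"
  proof -
    have "of_int p ^ ?n * (of_int (poly.coeff f j) * z ^ j)
        = of_int p * (of_int p ^ (?n - 1 - j) * (of_int (poly.coeff f j) * y ^ j))" if "j < ?n" for j
    proof -
      have "?n = Suc (?n - 1 - j) + j" using that by simp
      then have "(of_int p :: complex) ^ ?n = of_int p * of_int p ^ (?n - 1 - j) * of_int p ^ j"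
        by (metis power_Suc power_add)
      then show ?thesis by (simp add: y(2) power_mult_distrib)
    qed
    then have "(\<Sum>j<?n. of_int p ^ ?n * (of_int (poly.coeff f j) * z ^ j))
        = (\<Sum>j<?n. of_int p * (of_int p ^ (?n - 1 - j) * (of_int (poly.coeff f j) * y ^ j)))"
      by (intro sum.cong) auto
    then show ?thesis by (simp only: sum_distrib_left mult_minus_right)
  qed
  finally have "y ^ ?n = of_int p * (- (\<Sum>j<?n. of_int p ^ (?n - 1 - j) * (of_int (poly.coeff f j) * y ^ j)))" .
  moreover have "- (\<Sum>j<?n. of_int p ^ (?n - 1 - j) * (of_int (poly.coeff f j) * y ^ j)) \<in> A"
    by (intro subring_set_closed[OF A] subring_set_sum[OF A] y)
  ultimately show ?thesis by blast
qed

text \<open>Here \<open>N = (p, w)\<close> plays the role of the radical of \<open>p A\<close>. The assumptions on \<open>w\<close> and \<open>w'\<close>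
  make \<open>A\<close> maximal at \<open>p\<close>, so that \<open>A / N\<close> is a quotient of \<open>\<int>[\<eta>]\<close> and each of its
  elements lies in the span of \<open>1, \<eta>, \<dots>, \<eta>\<^sup>r\<^sup>-\<^sup>1\<close>.\<close>

lemma not_monogenic_core:
  fixes A B N :: "complex set" and p :: int and w w' \<eta> :: complex and v :: "nat \<Rightarrow> complex"
  assumes p: "Factorial_Ring.prime p"
    and B: "B = int_adjoin \<eta>" and integral: "\<And>z. z \<in> B \<Longrightarrow> algebraic_int z"
    and A: "subring_set A" "A \<subseteq> B"
    and denominators: "\<And>z. z \<in> B \<Longrightarrow> \<exists>d. d \<noteq> (0 :: int) \<and> of_int d * z \<in> A"
    and N_def: "N = ideal_gen A (of_int p) w"
    and w: "w \<in> A" "w' \<in> A" "w ^ 2 = of_int p * w'"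
    and reduced: "\<And>y. y \<in> A \<Longrightarrow> y ^ 2 \<in> N \<Longrightarrow> y \<in> N"
    and regular: "\<And>y. y \<in> A \<Longrightarrow> w' * y \<in> N \<Longrightarrow> \<exists>x\<in>A. w * y = of_int p * x"
    and relation: "\<And>y. y \<in> A \<Longrightarrow> \<exists>g :: int poly.
      Polynomial.lead_coeff g = 1 \<and> Polynomial.degree g = r \<and> poly (of_int_poly g) y \<in> N"
    and "r < d" and v: "\<And>i. i < d \<Longrightarrow> v i \<in> A"
    and independent: "\<And>c i. (\<Sum>i<d. of_int (c i) * v i) \<in> N \<Longrightarrow> i < d \<Longrightarrow> p dvd c i"
  shows False
proof -
  note A_closed = subring_set_closed[OF A(1)]
  have B': "subring_set B" unfolding B by (rule subring_set_int_adjoin)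
  note B_closed = subring_set_closed[OF B']
  have AB: "x \<in> B" if "x \<in> A" for x using that A by blast
  have p1: "p > 1" "p \<noteq> 0" using p by (auto simp: prime_gt_1_int)
  note N_add = ideal_gen_add[OF A(1), of _ "of_int p" w, folded N_def]
  note N_mult = ideal_gen_mult[OF A(1), of _ "of_int p" w, folded N_def]
  note N_p = ideal_gen_left[OF A(1), of _ "of_int p" w, folded N_def]
  have N_A: "x \<in> A" if "x \<in> N" for x
    using that ideal_gen_subset[OF A(1) A_closed(7) w(1)] unfolding N_def by blast
  \<comment> \<open>\<open>reduced\<close> only treats squares, so the exponent n is replaced by the
    upper half of n until it reaches 1.\<close>
  have power_reduced: "y \<in> N" if "y ^ n \<in> N" "y \<in> A" for y n
    using that
  proof (induction n rule: less_induct)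
    case (less n)
    consider "n = 0" | "n = 1" | "n \<ge> 2" by linarith
    then show ?case
    proof cases
      case 1
      with less N_mult[of 1 y] show ?thesis by simp
    next
      case 2
      with less show ?thesis by simp
    next
      case 3
      define k where "k = (n + 1) div 2"
      have "k < n" "n \<le> 2 * k" using 3 by (auto simp: k_def)
      have "(y ^ k) ^ 2 = y ^ (2 * k - n) * y ^ n"
        using \<open>n \<le> 2 * k\<close> by (simp flip: power_mult power_add add: mult.commute)
      then have "(y ^ k) ^ 2 \<in> N" using less.prems by (auto intro: N_mult A_closed)
      then have "y ^ k \<in> N" using less.prems by (auto intro: reduced A_closed)
      then show ?thesis using less \<open>k < n\<close> by blast
    qed
  qed
  have pB: "y \<in> N" if y: "y \<in> A" "y = of_int p * z" "z \<in> B" for y z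
  proof -
    obtain n x where "x \<in> A" "y ^ n = of_int p * x"
      using power_integral_in_span[OF A(1) y(1,2) integral[OF y(3)]] by blast
    then have "y ^ n \<in> N" using N_p by simp
    then show ?thesis using power_reduced y(1) by blast
  qed
  \<comment> \<open>As p z lies in N, the difference t of z and an element of A has the form w y /
    p. Squaring gives w' y^2 = p t^2, which again lies in N because t^2 is integral. Reducedness
    then puts w' y into N, and \<open>regular\<close> says exactly that such a y makes t an element
    of A.\<close>
  have maximal: "z \<in> A" if z: "z \<in> B" "of_int p * z \<in> A" for z
  proof -
    have "of_int p * z \<in> N" using pB[OF z(2) refl z(1)] .
    then obtain x y where xy: "x \<in> A" "y \<in> A" "of_int p * z = of_int p * x + w * y"
      unfolding N_def ideal_gen_def by blast
    define t where "t = z - x"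
    have t: "t \<in> B" "of_int p * t = w * y"
      using xy z AB by (auto simp: t_def algebra_simps intro!: B_closed)
    have "of_int p * (of_int p * t ^ 2) = (of_int p * t) ^ 2"
      by (simp add: power2_eq_square mult_ac)
    also have "\<dots> = of_int p * (w' * y ^ 2)"
      unfolding t by (simp add: power_mult_distrib w)
    finally have eq: "w' * y ^ 2 = of_int p * t ^ 2" using p1 by simp
    have "w' * y ^ 2 \<in> N"
      by (rule pB[OF _ eq]) (intro A_closed B_closed w xy t)+
    then have "w' * (w' * y ^ 2) \<in> N" using w N_mult by blast
    then have "(w' * y) ^ 2 \<in> N" by (simp add: power2_eq_square mult_ac)
    then have "w' * y \<in> N" using reduced w xy by (auto intro!: A_closed)
    then obtain x' where "x' \<in> A" "w * y = of_int p * x'" using regular xy by blast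
    then have "t = x'" using t p1 by simp
    then have "z = x + x'" by (simp add: t_def diff_eq_eq add.commute)
    then show ?thesis using xy \<open>x' \<in> A\<close> by (auto intro: A_closed)
  qed
  \<comment> \<open>Descent on the denominator: \<open>maximal\<close> removes one factor p at a
    time.\<close>
  have prime_to: "\<exists>m. coprime m p \<and> of_int m * z \<in> A" if "z \<in> B" for z
  proof -
    obtain d where d: "d \<noteq> 0" "of_int d * z \<in> A" using denominators \<open>z \<in> B\<close> by blast
    then show ?thesis
    proof (induction "nat \<bar>d\<bar>" arbitrary: d rule: less_induct)
      case less
      show ?case
      proof (cases "p dvd d")
        case True
        then obtain e where e: "d = p * e" by (elim dvdE)
        then have "of_int p * (of_int e * z) \<in> A" using less by (simp add: mult.assoc)
        then have "of_int e * z \<in> A"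
          by (rule maximal[OF B_closed(4)[OF B_closed(7) \<open>z \<in> B\<close>]])
        moreover have "e \<noteq> 0" "nat \<bar>e\<bar> < nat \<bar>d\<bar>"
          using e less.prems p1 by (auto simp: abs_mult)
        ultimately show ?thesis using \<open>of_int e * z \<in> A\<close> by (intro less.hyps)
      next
        case False
        then have "coprime d p" using prime_imp_coprime[OF p] coprime_commute by blast
        then show ?thesis using less.prems(2) by blast
      qed
    qed
  qed
  \<comment> \<open>The contraction to B of the extension of N to the localisation at p, written
    without fractions.\<close>
  define J where "J = {z \<in> B. \<exists>m. coprime m p \<and> of_int m * z \<in> N}"
  have JI: "z \<in> J" if "z \<in> B" "coprime m p" "of_int m * z \<in> N" for z m
    using that unfolding J_def by blast
  have J_add: "x + y \<in> J" if "x \<in> J" "y \<in> J" for x y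
  proof -
    obtain m n where mn: "coprime m p" "coprime n p" "of_int m * x \<in> N" "of_int n * y \<in> N" "x \<in> B" "y \<in> B"
      using \<open>x \<in> J\<close> \<open>y \<in> J\<close> unfolding J_def by blast
    have "of_int (m * n) * (x + y) = of_int n * (of_int m * x) + of_int m * (of_int n * y)"
      by (simp add: algebra_simps)
    then have "of_int (m * n) * (x + y) \<in> N" using mn by (auto intro!: N_add N_mult A_closed(7))
    moreover have "coprime (m * n) p" using mn by simp
    ultimately show ?thesis using mn B_closed(6) by (blast intro: JI)
  qed
  have J_mult: "b * x \<in> J" if "x \<in> J" "b \<in> B" for x b
  proof -
    obtain m n where mn: "coprime m p" "of_int m * x \<in> N" "x \<in> B" "coprime n p" "of_int n * b \<in> A"
      using \<open>x \<in> J\<close> prime_to[OF \<open>b \<in> B\<close>] unfolding J_def by blast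
    have "of_int (m * n) * (b * x) = (of_int n * b) * (of_int m * x)"
      by (simp add: algebra_simps)
    then have "of_int (m * n) * (b * x) \<in> N" using N_mult[OF mn(2,5)] by (simp only:)
    moreover have "coprime (m * n) p" using mn by simp
    ultimately show ?thesis using mn \<open>b \<in> B\<close> B_closed(4) by (blast intro: JI)
  qed
  have NJ: "x \<in> J" if "x \<in> N" for x
    using JI[of x 1] that AB[OF N_A[OF that]] by simp
  have pJ: "of_int p * x \<in> J" if "x \<in> B" for x
    using J_mult[OF NJ[OF N_p[OF A_closed(2)]] that] by (simp add: mult.commute)
  have \<eta>: "\<eta> \<in> B" unfolding B int_adjoin_def by (rule generate_ring.incl) simp
  obtain m where m: "coprime m p" "of_int m * \<eta> \<in> A" using prime_to[OF \<eta>] by blast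
  \<comment> \<open>\<open>relation\<close> speaks about elements of A, while \<eta> need not lie in
    A. With k an inverse of m modulo p, the element k m \<eta> lies in A and is congruent to \<eta>
    modulo p B.\<close>
  obtain k where "[m * k = 1] (mod p)" using m cong_solve_coprime_int by blast
  then have "p dvd m * k - 1" by (simp add: cong_iff_dvd_diff add.commute)
  then obtain s where "m * k - 1 = p * s" by (elim dvdE)
  then have s: "m * k = 1 + p * s" by simp
  have k: "of_int k * (of_int m * \<eta>) = \<eta> + of_int p * (of_int s * \<eta>)"
  proof -
    have "of_int k * (of_int m * \<eta>) = of_int (m * k) * \<eta>" by simp
    then show ?thesis unfolding s by (simp add: algebra_simps)
  qed
  have "\<eta> + of_int p * (of_int s * \<eta>) \<in> A"
    unfolding k[symmetric] by (rule A_closed(4)[OF A_closed(7) m(2)])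
  then obtain g :: "int poly" where g: "Polynomial.lead_coeff g = 1" "Polynomial.degree g = r"
    "poly (of_int_poly g) (\<eta> + of_int p * (of_int s * \<eta>)) \<in> N" using relation by blast
  obtain t where t: "t \<in> B"
    "poly (of_int_poly g) (\<eta> + of_int p * (of_int s * \<eta>)) = poly (of_int_poly g) \<eta> + of_int p * t"
    using poly_congruent[OF B' \<eta> B_closed(4)[OF B_closed(7) \<eta>]] by blast
  have "poly (of_int_poly g) \<eta> = poly (of_int_poly g) (\<eta> + of_int p * (of_int s * \<eta>)) + of_int p * (- t)"
    using t by simp
  then have g\<eta>: "poly (of_int_poly g) \<eta> \<in> J"
    using J_add[OF NJ[OF g(3)] pJ[OF B_closed(5)[OF t(1)]]] by simp
  \<comment> \<open>Division by the monic g leaves a remainder of degree below r, so the powers of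
    \<eta> below r span the image of A in B / J.\<close>
  have "\<exists>c. v i - (\<Sum>j<r. of_int (c j) * \<eta> ^ j) \<in> J" if "i < d" for i
  proof -
    obtain h where h: "v i = poly (of_int_poly h) \<eta>"
      using AB[OF v[OF \<open>i < d\<close>]] unfolding B int_adjoin_eq_polys by blast
    obtain q m where qm: "h = g * q + m" "m = 0 \<or> Polynomial.degree m < r"
      using monic_division[OF g(1), of h] g(2) by blast
    have "v i = poly (of_int_poly g) \<eta> * poly (of_int_poly q) \<eta> + (\<Sum>j<r. of_int (poly.coeff m j) * \<eta> ^ j)"
      unfolding h qm(1) poly_as_sum_below[OF qm(2), symmetric]
      by (simp add: of_int_poly_hom.hom_add of_int_poly_hom.hom_mult)
    then show ?thesis
      using J_mult[OF g\<eta> subring_set_poly[OF B' \<eta>], of q]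
      by (intro exI[of _ "poly.coeff m"]) (simp add: mult.commute)
  qed
  then obtain c where c: "\<And>i. i < d \<Longrightarrow> v i - (\<Sum>j<r. of_int (c i j) * \<eta> ^ j) \<in> J" by metis
  have "\<exists>c i. i < d \<and> \<not> p dvd c i \<and> (\<Sum>i<d. of_int (c i) * v i) \<in> J"
    by (rule dependence_mod[where w = "\<lambda>j. \<eta> ^ j" and m = c])
      (use p1 \<open>r < d\<close> J_add J_mult[OF _ B_closed(7)] pJ[OF B_closed(9)[OF \<eta>]] c
        NJ[OF N_p[OF A_closed(1)]] in auto)
  then obtain k i where k: "i < d" "\<not> p dvd k i" "(\<Sum>i<d. of_int (k i) * v i) \<in> J" by blast
  then obtain n where n: "coprime n p" "of_int n * (\<Sum>i<d. of_int (k i) * v i) \<in> N"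
    unfolding J_def by blast
  have "of_int n * (\<Sum>i<d. of_int (k i) * v i) = (\<Sum>i<d. of_int (n * k i) * v i)"
    by (simp add: sum_distrib_left mult.assoc)
  with n independent[of "\<lambda>i. n * k i" i] \<open>i < d\<close> have "p dvd n * k i" by simp
  then show False
    using n k by (simp add: coprime_dvd_mult_right_iff coprime_commute)
qed

text \<open>The basis is ordered so that the first d members stay independent modulo N. By
  \<open>w_mult\<close>, N lies in the lattice spanned by p e_i for i < d and by e_i for the other
  i; comparing coordinates shows that a combination of the first d members in N has all coefficients
  divisible by p.\<close>

lemma not_monogenic_span:
  fixes F :: "int poly" and x w w' :: complex and e :: "nat \<Rightarrow> complex"
  assumes irr: "Factorial_Ring.irreducible (map_poly rat_of_int F)"
    and root: "poly (of_int_poly F) x = 0"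
    and e: "\<And>i. i < n \<Longrightarrow> e i \<in> rat_adjoin x"
    and unique: "\<And>c i. (\<Sum>i<n. of_int (c i) * e i) = 0 \<Longrightarrow> i < n \<Longrightarrow> c i = (0 :: int)"
    and T_def: "T = int_span n e" and "1 \<in> T" "x \<in> T"
    and mult: "\<And>i y. i < n \<Longrightarrow> y \<in> T \<Longrightarrow> e i * y \<in> T"
    and p: "Factorial_Ring.prime p" and N_def: "N = ideal_gen T (of_int p) w"
    and w: "w \<in> T" "w' \<in> T" "w ^ 2 = of_int p * w'"
    and w_mult: "\<And>i. i < n \<Longrightarrow> w * e i \<in> int_span n (\<lambda>i. if i < d then of_int p * e i else e i)"
    and reduced: "\<And>y. y \<in> T \<Longrightarrow> y ^ 2 \<in> N \<Longrightarrow> y \<in> N"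
    and regular: "\<And>y. y \<in> T \<Longrightarrow> w' * y \<in> N \<Longrightarrow> \<exists>x\<in>T. w * y = of_int p * x"
    and relation: "\<And>y. y \<in> T \<Longrightarrow> \<exists>g :: int poly.
      Polynomial.lead_coeff g = 1 \<and> Polynomial.degree g = r \<and> poly (of_int_poly g) y \<in> N"
    and "r < d" "d \<le> n"
  shows "\<not> monogenic (rat_adjoin x)"
proof
  assume "monogenic (rat_adjoin x)"
  then obtain \<eta> where \<eta>: "ring_of_integers (rat_adjoin x) = int_adjoin \<eta>"
    unfolding monogenic_def by blast
  have T_mult: "y * z \<in> T" if "y \<in> T" "z \<in> T" for y z
    using int_span_mult_left[of n z e n e y] mult[OF _ \<open>z \<in> T\<close>] \<open>y \<in> T\<close>
    unfolding T_def by (simp add: mult.commute)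
  have T: "subring_set T"
    unfolding subring_set_def using \<open>1 \<in> T\<close> T_mult int_span_diff unfolding T_def by blast
  have "e 0 \<noteq> 0" "0 < n"
  proof -
    show "0 < n" using \<open>r < d\<close> \<open>d \<le> n\<close> by simp
    then show "e 0 \<noteq> 0"
      using unique[of "\<lambda>i. if i = 0 then 1 else 0" 0]
      by (auto simp: if_distrib if_distribR cong: if_cong)
  qed
  have "T \<subseteq> int_adjoin \<eta>"
  proof
    fix y assume "y \<in> T"
    have "int_span n e \<subseteq> rat_adjoin x"
      by (rule int_span_subset_subring[OF subring_set_rat_adjoin]) (rule e)
    then have "y \<in> rat_adjoin x" using \<open>y \<in> T\<close> unfolding T_def by blast
    moreover have "algebraic_int y"
      using \<open>0 < n\<close> \<open>e 0 \<noteq> 0\<close>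
      by (rule algebraic_int_int_span[rotated])
        (use mult[OF _ \<open>y \<in> T\<close>] in \<open>auto simp: T_def mult.commute\<close>)
    ultimately show "y \<in> int_adjoin \<eta>"
      unfolding \<eta>[symmetric] ring_of_integers_def by simp
  qed
  show False
  proof (rule not_monogenic_core[OF p refl _ T \<open>T \<subseteq> int_adjoin \<eta>\<close> _ N_def w reduced regular relation
        \<open>r < d\<close>, where v = e])
    show "algebraic_int z" if "z \<in> int_adjoin \<eta>" for z
      using that unfolding \<eta>[symmetric] ring_of_integers_def by simp
    show "\<exists>k. k \<noteq> (0 :: int) \<and> of_int k * z \<in> T" if "z \<in> int_adjoin \<eta>" for z
    proof -
      have "z \<in> rat_adjoin x" using that unfolding \<eta>[symmetric] ring_of_integers_def by simp
      then show ?thesis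
        using rat_adjoin_common_denominator[OF irr root] subring_set_poly[OF T \<open>x \<in> T\<close>] by metis
    qed
    show "e i \<in> T" if "i < d" for i
      using that \<open>d \<le> n\<close> unfolding T_def by (auto intro: int_span_base)
    fix c i assume c: "(\<Sum>i<d. of_int (c i) * e i) \<in> N" and "i < d"
    define f where "f i = (if i < d then of_int p * e i else e i)" for i
    have "N \<subseteq> int_span n f"
    proof -
      have "of_int p * e i \<in> int_span n f" if "i < n" for i
        using that int_span_base[of i n f] int_span_scale[of "f i" n f p]
        by (cases "i < d") (auto simp: f_def)
      then have "of_int p * y \<in> int_span n f" if "y \<in> T" for y
        using int_span_mult_left that unfolding T_def by blast
      moreover have "w * y \<in> int_span n f" if "y \<in> T" for y
        using int_span_mult_left w_mult that unfolding T_def f_def[abs_def, symmetric] by blast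
      ultimately show ?thesis
        unfolding N_def ideal_gen_def by (auto intro: int_span_add)
    qed
    then obtain k where k: "(\<Sum>i<d. of_int (c i) * e i) = (\<Sum>i<n. of_int (k i) * f i)"
      using c unfolding int_span_def by blast
    \<comment> \<open>The coordinates of the difference of the two expressions; their vanishing for
      i < d is the required divisibility.\<close>
    define c' where "c' i = (if i < d then c i - p * k i else - k i)" for i
    have "(\<Sum>i<d. of_int (c i) * e i) = (\<Sum>i<n. of_int (if i < d then c i else 0) * e i)"
      using \<open>d \<le> n\<close> by (intro sum.mono_neutral_cong_left) auto
    then have "(\<Sum>i<n. of_int (if i < d then c i else 0) * e i - of_int (k i) * f i) = 0"
      using k by (simp add: sum_subtractf)
    moreover have "of_int (if i < d then c i else 0) * e i - of_int (k i) * f i = of_int (c' i) * e i" for i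
      by (simp add: c'_def f_def algebra_simps)
    ultimately have "(\<Sum>i<n. of_int (c' i) * e i) = 0" by simp
    then have "c' i = 0" using \<open>i < d\<close> \<open>d \<le> n\<close> by (intro unique) auto
    then show "p dvd c i" using \<open>i < d\<close> by (simp add: c'_def)
  qed
qed

section \<open>Identities y^q = y modulo the radical\<close>

text \<open>Reduces y^q = y modulo N to a test on ring generators. Differences are treated as x +
  (-1) y, which is why -1 itself must satisfy the equation; for even q this rests on 2 being in
  N.\<close>

lemma subring_set_frobenius:
  assumes A: "subring_set A" and N_def: "N = ideal_gen A (of_int p) w" and w: "w \<in> A"
    and binomial: "\<And>x y. x \<in> A \<Longrightarrow> y \<in> A \<Longrightarrow> \<exists>t\<in>A. (x + y) ^ q = x ^ q + y ^ q + of_int p * t"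
    and minus: "(- 1) ^ q + 1 \<in> N"
  shows "subring_set {y \<in> A. y ^ q - y \<in> N}"
proof -
  note N = ideal_gen_left[OF A, of _ "of_int p" w, folded N_def]
    ideal_gen_add[OF A, of _ "of_int p" w, folded N_def]
    ideal_gen_mult[OF A, of _ "of_int p" w, folded N_def]
  note A_closed = subring_set_closed[OF A]
  have add: "(x + y) ^ q - (x + y) \<in> N" if xy: "x \<in> A" "y \<in> A" "x ^ q - x \<in> N" "y ^ q - y \<in> N" for x y
  proof -
    obtain t where "t \<in> A" "(x + y) ^ q = x ^ q + y ^ q + of_int p * t" using binomial xy by blast
    then have "(x + y) ^ q - (x + y) = (x ^ q - x) + (y ^ q - y) + of_int p * t" by simp
    then show ?thesis using N xy \<open>t \<in> A\<close> by metis
  qed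
  have mult: "(x * y) ^ q - x * y \<in> N" if xy: "x \<in> A" "y \<in> A" "x ^ q - x \<in> N" "y ^ q - y \<in> N" for x y
  proof -
    have "(x * y) ^ q - x * y = y ^ q * (x ^ q - x) + x * (y ^ q - y)"
      by (simp add: power_mult_distrib algebra_simps)
    then show ?thesis using N(2,3) xy A_closed(9) by metis
  qed
  have "x - y = x + (- 1) * y" for x y :: complex by simp
  moreover have "0 \<in> N" using N(1)[OF A_closed(1)] by simp
  moreover have "(- 1) ^ q - (- 1) \<in> N" using minus by simp
  ultimately show ?thesis
    unfolding subring_set_def using add mult A_closed(2,3,4,5) by (smt (verit) mem_Collect_eq power_one diff_self)
qed

text \<open>The hypothesis on \<open>q\<close>-th powers says that all residue fields of \<open>T\<close> at \<open>p\<close> are contained in the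
  field with \<open>q\<close> elements.\<close>

lemma not_monogenic_frobenius:
  fixes F :: "int poly" and x w w' :: complex and e :: "nat \<Rightarrow> complex"
  assumes irr: "Factorial_Ring.irreducible (map_poly rat_of_int F)"
    and root: "poly (of_int_poly F) x = 0"
    and e: "\<And>i. i < n \<Longrightarrow> e i \<in> rat_adjoin x"
    and unique: "\<And>c i. (\<Sum>i<n. of_int (c i) * e i) = 0 \<Longrightarrow> i < n \<Longrightarrow> c i = (0 :: int)"
    and T_def: "T = int_span n e" and one: "1 \<in> T" and "x \<in> T"
    and mult: "\<And>i y. i < n \<Longrightarrow> y \<in> T \<Longrightarrow> e i * y \<in> T"
    and p: "Factorial_Ring.prime p" and N_def: "N = ideal_gen T (of_int p) w"
    and w: "w \<in> T" "w' \<in> T" "w ^ 2 = of_int p * w'"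
    and w_mult: "\<And>i. i < n \<Longrightarrow> w * e i \<in> int_span n (\<lambda>i. if i < d then of_int p * e i else e i)"
    and regular: "\<And>y. y \<in> T \<Longrightarrow> w' * y \<in> N \<Longrightarrow> \<exists>x\<in>T. w * y = of_int p * x"
    and pq: "p = 2 \<and> q = 4 \<or> p = 3 \<and> q = 3"
    and generated: "\<And>S i. subring_set S \<Longrightarrow> G \<subseteq> S \<Longrightarrow> i < n \<Longrightarrow> e i \<in> S" and "G \<subseteq> T"
    and frobenius: "\<And>y. y \<in> G \<Longrightarrow> y ^ q - y \<in> N"
    and "q < d" "d \<le> n"
  shows "\<not> monogenic (rat_adjoin x)"
proof -
  have T_mult: "y * z \<in> T" if "y \<in> T" "z \<in> T" for y z
    using int_span_mult_left[of n z e n e y] mult[OF _ \<open>z \<in> T\<close>] \<open>y \<in> T\<close>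
    unfolding T_def by (simp add: mult.commute)
  have T: "subring_set T"
    unfolding subring_set_def using \<open>1 \<in> T\<close> T_mult int_span_diff unfolding T_def by blast
  note T_closed = subring_set_closed[OF T]
  \<comment> \<open>The inner binomial coefficients 4, 6, 4 are divisible by 2, and 3, 3 by 3; the
    witnesses are the quotients.\<close>
  have binomial: "\<exists>t\<in>T. (x + y) ^ q = x ^ q + y ^ q + of_int p * t" if "x \<in> T" "y \<in> T" for x y
    using pq
  proof
    assume pq: "p = 2 \<and> q = 4"
    show ?thesis
      by (rule bexI[of _ "2 * x ^ 3 * y + 3 * x ^ 2 * y ^ 2 + 2 * x * y ^ 3"])
        (use pq that in \<open>auto intro!: T_closed simp: algebra_simps power2_eq_square power3_eq_cube power4_eq_xxxx\<close>)
  next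
    assume pq: "p = 3 \<and> q = 3"
    show ?thesis
      by (rule bexI[of _ "x ^ 2 * y + x * y ^ 2"])
        (use pq that in \<open>auto intro!: T_closed simp: algebra_simps power2_eq_square power3_eq_cube\<close>)
  qed
  have minus: "(- 1) ^ q + 1 \<in> N"
    using pq ideal_gen_left[OF T, of 1 2 w] ideal_gen_left[OF T, of 0 3 w] T_closed(1,2)
    unfolding N_def by auto
  have "subring_set {y \<in> T. y ^ q - y \<in> N}"
    by (rule subring_set_frobenius[OF T N_def w(1)]) (use binomial minus in auto)
  then have "int_span n e \<subseteq> {y \<in> T. y ^ q - y \<in> N}"
    by (rule int_span_subset_subring) (rule generated, use \<open>G \<subseteq> T\<close> frobenius
      \<open>subring_set {y \<in> T. y ^ q - y \<in> N}\<close> in auto)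
  then have power_q: "y ^ q - y \<in> N" if "y \<in> T" for y using that unfolding T_def by blast
  have "q \<ge> 2" using pq by auto
  have relation: "\<exists>g :: int poly. Polynomial.lead_coeff g = 1 \<and> Polynomial.degree g = q \<and>
      poly (of_int_poly g) y \<in> N" if "y \<in> T" for y
    using pq
  proof
    assume "p = 2 \<and> q = 4"
    then show ?thesis using power_q[OF that]
      by (intro exI[of _ "[:0, - 1, 0, 0, 1:]"]) (simp add: algebra_simps eval_nat_numeral)
  next
    assume "p = 3 \<and> q = 3"
    then show ?thesis using power_q[OF that]
      by (intro exI[of _ "[:0, - 1, 0, 1:]"]) (simp add: algebra_simps eval_nat_numeral)
  qed
  \<comment> \<open>If y^2 is in N, so is y^q, and y is the difference of y^q and y^q - y.\<close>
  have reduced: "y \<in> N" if y: "y \<in> T" "y ^ 2 \<in> N" for y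
  proof -
    have "y ^ (q - 2) * y ^ 2 \<in> N"
      unfolding N_def by (intro ideal_gen_mult[OF T] T_closed y(1) y(2)[unfolded N_def])
    also have "y ^ (q - 2) * y ^ 2 = y ^ q"
      using \<open>q \<ge> 2\<close> by (metis le_add_diff_inverse2 power_add)
    finally show "y \<in> N"
      using ideal_gen_diff[OF T, of "y ^ q" "of_int p" w "y ^ q - y"] power_q[OF y(1)]
      unfolding N_def by simp
  qed
  show ?thesis
    by (rule not_monogenic_span[where F = F and e = e and n = n and T = T and N = N and p = p
          and w = w and w' = w' and r = q and d = d])
      (fact assms reduced relation)+
qed

lemma less_6_iff: "i < 6 \<longleftrightarrow> i = 0 \<or> i = 1 \<or> i = 2 \<or> i = 3 \<or> i = 4 \<or> i = (5 :: nat)"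
  by auto

lemma sum_less_6: "(\<Sum>i<6. f i) = f 0 + f 1 + f 2 + f 3 + f 4 + (f (5 :: nat) :: 'a :: comm_monoid_add)"
  by (simp add: eval_nat_numeral add.assoc)

lemma powers_independent:
  fixes F :: "int poly"
  assumes "Factorial_Ring.irreducible (map_poly rat_of_int F)" "poly (of_int_poly F) x = 0"
    and "Polynomial.degree F = 6"
    and zero: "of_int c0 + of_int c1 * x + of_int c2 * x ^ 2 + of_int c3 * x ^ 3 + of_int c4 * x ^ 4
      + of_int c5 * x ^ 5 = (0 :: complex)"
  shows "c0 = 0 \<and> c1 = 0 \<and> c2 = 0 \<and> c3 = 0 \<and> c4 = 0 \<and> c5 = 0"
proof -
  let ?h = "[:c0, c1, c2, c3, c4, c5:]"
  have "poly (of_int_poly ?h) x = 0"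
    using zero by (simp add: of_int_hom.map_poly_pCons_hom algebra_simps eval_nat_numeral)
  moreover have "Polynomial.degree ?h < 6"
    by (simp add: degree_pCons_eq_if)
  ultimately have "?h = 0"
    using degree_le_vanishing[OF assms(1,2), of ?h] assms(3) by fastforce
  then show ?thesis by simp
qed

section \<open>The three families of sextic trinomials\<close>

text \<open>Conditions (1) and (3) are the cases c = 0 and c = 1. Here F = (x^3 - 1)^2 + 2 (x^3 - 1)
  + 4 (2 a x + 2 b + c), so \<alpha> = (\<theta>^3 - 1) / 2 satisfies an integral equation that is
  y^2 + y + c modulo 2. Hence T / 2 is F_2[x, y] / (x^3 - 1, y^2 + y + c), a product of fields
  contained in F_4.\<close>

lemma not_monogenic_8:
  fixes \<theta> :: complex and a b c :: int
  assumes F: "F = [:8 * b + 4 * c - 1, 8 * a, 0, 0, 0, 0, 1:]"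
    and irr: "Factorial_Ring.irreducible (map_poly rat_of_int F)"
    and root: "poly (of_int_poly F) \<theta> = 0"
  shows "\<not> monogenic (rat_adjoin \<theta>)"
proof -
  define A B C :: complex where "A = of_int a" and "B = of_int b" and "C = of_int c"
  define \<alpha> where "\<alpha> = (\<theta> ^ 3 - 1) / 2"
  have \<theta>6: "\<theta> ^ 6 = 1 - 4 * C - 8 * B - 8 * A * \<theta>"
    using root unfolding F A_def B_def C_def
    by (simp add: of_int_hom.map_poly_pCons_hom eval_nat_numeral algebra_simps eq_neg_iff_add_eq_0 add_eq_0_iff2)
  have \<theta>3: "\<theta> ^ 3 = 2 * \<alpha> + 1" by (simp add: \<alpha>_def)
  have "4 * (\<alpha> ^ 2 + \<alpha> + 2 * A * \<theta> + 2 * B + C) = 0" using \<theta>6 \<theta>3 by Groebner_Basis.algebra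
  then have \<alpha>2: "\<alpha> ^ 2 + \<alpha> + 2 * A * \<theta> + 2 * B + C = 0"
    by (simp only: mult_eq_0_iff) simp
  define e where "e i = [1, \<theta>, \<theta> ^ 2, \<alpha>, \<alpha> * \<theta>, \<alpha> * \<theta> ^ 2] ! i" for i
  have e [simp]: "e 0 = 1" "e (Suc 0) = \<theta>" "e 2 = \<theta> ^ 2" "e 3 = \<alpha>" "e 4 = \<alpha> * \<theta>" "e 5 = \<alpha> * \<theta> ^ 2"
    by (simp_all add: e_def)
  define T where "T = int_span 6 e"
  note T_intros = int_span_intros[where n = 6 and e = e, folded T_def]
  have T_scale: "A * y \<in> T" "B * y \<in> T" "C * y \<in> T" if "y \<in> T" for y
    using that unfolding A_def B_def C_def T_def by (auto intro: int_span_scale)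
  have base: "1 \<in> T" "\<theta> \<in> T" "\<theta> ^ 2 \<in> T" "\<alpha> \<in> T" "\<alpha> * \<theta> \<in> T" "\<alpha> * \<theta> ^ 2 \<in> T"
    using int_span_base[of _ 6 e] unfolding T_def by (force simp: less_6_iff)+
  note T_rules = T_intros(2-) T_scale base
  have \<theta>T: "\<theta> * y \<in> T" if "y \<in> T" for y
    using that unfolding T_def
  proof (rule int_span_mult_left[rotated], fold T_def)
    have 1: "\<theta> * \<theta> ^ 2 = 2 * \<alpha> + 1"
      using \<theta>3 by Groebner_Basis.algebra
    have 2: "\<theta> * (\<alpha> * \<theta> ^ 2) = - \<alpha> - 4 * (A * \<theta>) - 4 * (B * 1) - 2 * (C * 1)"
      using \<theta>3 \<alpha>2 by Groebner_Basis.algebra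
    have "\<theta> * \<theta> ^ 2 \<in> T" "\<theta> * (\<alpha> * \<theta> ^ 2) \<in> T" unfolding 1 2 by (intro T_rules)+
    then show "\<theta> * e i \<in> T" if "i < 6" for i
      using that base by (auto simp: less_6_iff power2_eq_square mult_ac)
  qed
  have \<alpha>T: "\<alpha> * y \<in> T" if "y \<in> T" for y
    using that unfolding T_def
  proof (rule int_span_mult_left[rotated], fold T_def)
    have *: "\<alpha> * \<alpha> = - \<alpha> - 2 * (A * \<theta>) - 2 * (B * 1) - C * 1"
      using \<alpha>2 by Groebner_Basis.algebra
    have "\<alpha> * \<alpha> \<in> T" unfolding * by (intro T_rules)
    then have "\<alpha> * \<alpha> \<in> T" "\<theta> * (\<alpha> * \<alpha>) \<in> T" "\<theta> * (\<theta> * (\<alpha> * \<alpha>)) \<in> T" by (auto intro: \<theta>T)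
    then show "\<alpha> * e i \<in> T" if "i < 6" for i
      using that base by (auto simp: less_6_iff power2_eq_square mult_ac)
  qed
  have e_mult: "e i * y \<in> T" if "i < 6" "y \<in> T" for i y
    using that \<theta>T \<alpha>T by (auto simp: less_6_iff power2_eq_square mult.assoc)
  have \<alpha>K: "\<alpha> \<in> rat_adjoin \<theta>"
    unfolding \<alpha>_def
    by (intro rat_adjoin_divide subring_set_closed[OF subring_set_rat_adjoin] rat_adjoin_self)
  have T: "subring_set T"
    unfolding subring_set_def
  proof (intro conjI ballI)
    show "x * y \<in> T" if "x \<in> T" "y \<in> T" for x y
      using int_span_mult_left[of 6 y e 6 e x] e_mult that unfolding T_def by (simp add: mult.commute)
  qed (auto intro: T_intros base)
  note T_closed = subring_set_closed[OF T]
  define N where "N = ideal_gen T (of_int 2) 0"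
  note two = ideal_gen_left[OF T, of _ "of_int 2" 0, folded N_def, simplified]
  have "\<theta> ^ 4 - \<theta> = 2 * (\<alpha> * \<theta>)" using \<theta>3 by Groebner_Basis.algebra
  then have \<theta>4: "\<theta> ^ 4 - \<theta> \<in> N" using two base by simp
  have \<alpha>4: "\<alpha> ^ 4 - \<alpha> \<in> N"
  proof -
    \<comment> \<open>Modulo 2, \<alpha>^2 = \<alpha> + c gives \<alpha>^4 = \<alpha> + c + c^2, so
      c^2 = c modulo 2 is what remains.\<close>
    have "even (c * c - c)" by simp
    then obtain k where "c * c - c = 2 * k" by (elim evenE)
    then have k: "C * C - C = 2 * of_int k"
      unfolding C_def by (metis of_int_diff of_int_mult of_int_numeral)
    define R where "R = A * \<theta> + B * 1"
    have "\<alpha> ^ 4 - \<alpha> = 2 * (\<alpha> * (2 * R + C * 1) - \<alpha> + 2 * (R * R) + 2 * (C * R) - R + of_int k * 1)"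
      using \<alpha>2 k unfolding R_def by Groebner_Basis.algebra
    moreover have "R \<in> T" unfolding R_def by (intro T_rules)
    then have "\<alpha> * (2 * R + C * 1) - \<alpha> + 2 * (R * R) + 2 * (C * R) - R + of_int k * 1 \<in> T"
      by (intro T_rules subring_set_mult[OF T])
    ultimately show ?thesis by (metis two)
  qed
  \<comment> \<open>The ideal 2 T is already radical, hence the second generator 0 and d =
    6.\<close>
  show ?thesis
  proof (rule not_monogenic_frobenius[where F = F and e = e and n = 6 and T = T and N = N and p = 2
        and w = 0 and w' = 0 and q = 4 and d = 6 and G = "{\<theta>, \<alpha>}"])
    show "e i \<in> rat_adjoin \<theta>" if "i < 6" for i
      using that subring_set_closed[OF subring_set_rat_adjoin[of \<theta>]] rat_adjoin_self \<alpha>K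
      by (auto simp: less_6_iff)
    show "k i = 0" if "(\<Sum>i<6. of_int (k i) * e i) = 0" and "i < 6" for k i
    proof -
      have "2 * (of_int (k 0) + of_int (k 1) * \<theta> + of_int (k 2) * \<theta> ^ 2 + of_int (k 3) * \<alpha>
          + of_int (k 4) * (\<alpha> * \<theta>) + of_int (k 5) * (\<alpha> * \<theta> ^ 2)) = 0"
        using that(1) by (simp add: sum_less_6)
      then have "of_int (2 * k 0 - k 3) + of_int (2 * k 1 - k 4) * \<theta> + of_int (2 * k 2 - k 5) * \<theta> ^ 2
          + of_int (k 3) * \<theta> ^ 3 + of_int (k 4) * \<theta> ^ 4 + of_int (k 5) * \<theta> ^ 5 = 0"
        using \<theta>3 unfolding of_int_diff of_int_mult of_int_numeral by Groebner_Basis.algebra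
      from powers_independent[OF irr root _ this] have
        "2 * k 0 - k 3 = 0 \<and> 2 * k 1 - k 4 = 0 \<and> 2 * k 2 - k 5 = 0 \<and> k 3 = 0 \<and> k 4 = 0 \<and> k 5 = 0"
        by (simp add: F)
      then show ?thesis using \<open>i < 6\<close> by (auto simp: less_6_iff)
    qed
    show "e i \<in> S" if "subring_set S" "{\<theta>, \<alpha>} \<subseteq> S" "i < 6" for S i
      using that(2,3) subring_set_closed[OF that(1)] by (auto simp: less_6_iff)
    show "0 * e i \<in> int_span 6 (\<lambda>i. if i < 6 then of_int 2 * e i else e i)" for i
      by (simp add: int_span_0)
    show "\<exists>x\<in>T. 0 * y = of_int 2 * x" for y
      using T_closed by (intro bexI[of _ 0]) auto
  qed (use irr root T_def N_def base e_mult \<theta>4 \<alpha>4 T_closed(1) in auto)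
qed

text \<open>In terms of w = \<theta>^2 - 1 the equation of \<theta> is w^3 + 3 w^2 + 3 w + 9 (a
  \<theta> + b) = 0. With \<alpha> = w (w + 3) / 3 this reads w (\<alpha> + 1) = -3 (a \<theta> +
  b), whence \<alpha> (\<alpha> + 1) = -(w + 3) (a \<theta> + b). Modulo (3, w) there remain
  \<theta>^2 = 1 and \<alpha> (\<alpha> + 1) = 0, that is, four points over F_3.\<close>

lemma not_monogenic_9:
  fixes \<theta> :: complex and a b :: int
  assumes F: "F = [:9 * b - 1, 9 * a, 0, 0, 0, 0, 1:]"
    and irr: "Factorial_Ring.irreducible (map_poly rat_of_int F)"
    and root: "poly (of_int_poly F) \<theta> = 0"
  shows "\<not> monogenic (rat_adjoin \<theta>)"
proof -
  define A B :: complex where "A = of_int a" and "B = of_int b"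
  define w where "w = \<theta> ^ 2 - 1"
  define \<alpha> where "\<alpha> = w ^ 2 / 3 + w"
  have \<theta>6: "\<theta> ^ 6 = 1 - 9 * B - 9 * A * \<theta>"
    using root unfolding F A_def B_def
    by (simp add: of_int_hom.map_poly_pCons_hom eval_nat_numeral algebra_simps eq_neg_iff_add_eq_0 add_eq_0_iff2)
  have \<theta>2: "\<theta> ^ 2 = w + 1" by (simp add: w_def)
  have w2: "w ^ 2 = 3 * (\<alpha> - w)" by (simp add: \<alpha>_def)
  have "3 * (w * \<alpha> + w + 3 * A * \<theta> + 3 * B) = 0"
    using \<theta>6 \<theta>2 w2 by Groebner_Basis.algebra
  then have w\<alpha>: "w * \<alpha> + w + 3 * A * \<theta> + 3 * B = 0"
    by (simp only: mult_eq_0_iff) simp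
  have "3 * (\<alpha> ^ 2 + \<alpha> + (A * \<theta> + B) * (w + 3)) = 0"
    using w\<alpha> \<theta>2 w2 by Groebner_Basis.algebra
  then have \<alpha>2: "\<alpha> ^ 2 + \<alpha> + (A * \<theta> + B) * (w + 3) = 0"
    by (simp only: mult_eq_0_iff) simp
  define e where "e i = [1, \<theta>, \<alpha>, \<alpha> * \<theta>, w, w * \<theta>] ! i" for i
  have e [simp]: "e 0 = 1" "e (Suc 0) = \<theta>" "e 2 = \<alpha>" "e 3 = \<alpha> * \<theta>" "e 4 = w" "e 5 = w * \<theta>"
    by (simp_all add: e_def)
  define T where "T = int_span 6 e"
  note T_intros = int_span_intros[where n = 6 and e = e, folded T_def]
  have T_scale: "A * y \<in> T" "B * y \<in> T" if "y \<in> T" for y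
    using that unfolding A_def B_def T_def by (auto intro: int_span_scale)
  have base: "1 \<in> T" "\<theta> \<in> T" "\<alpha> \<in> T" "\<alpha> * \<theta> \<in> T" "w \<in> T" "w * \<theta> \<in> T"
    using int_span_base[of _ 6 e] unfolding T_def by (force simp: less_6_iff)+
  note T_rules = T_intros(2-) T_scale base
  have \<theta>T: "\<theta> * y \<in> T" if "y \<in> T" for y
    using that unfolding T_def
  proof (rule int_span_mult_left[rotated], fold T_def)
    have 1: "\<theta> * \<theta> = w + 1"
      using \<theta>2 by Groebner_Basis.algebra
    have 2: "\<theta> * (\<alpha> * \<theta>) = \<alpha> - w - 3 * (A * \<theta>) - 3 * (B * 1)"
      using \<theta>2 w\<alpha> by Groebner_Basis.algebra
    have 3: "\<theta> * (w * \<theta>) = 3 * \<alpha> - 2 * w"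
      using \<theta>2 w2 by Groebner_Basis.algebra
    have "\<theta> * \<theta> \<in> T" "\<theta> * (\<alpha> * \<theta>) \<in> T" "\<theta> * (w * \<theta>) \<in> T" unfolding 1 2 3 by (intro T_rules)+
    then show "\<theta> * e i \<in> T" if "i < 6" for i
      using that base by (auto simp: less_6_iff mult_ac)
  qed
  have \<alpha>T: "\<alpha> * y \<in> T" if "y \<in> T" for y
    using that unfolding T_def
  proof (rule int_span_mult_left[rotated], fold T_def)
    have 1: "\<alpha> * \<alpha> = - \<alpha> - A * (w * \<theta>) - B * w - 3 * (A * \<theta>) - 3 * (B * 1)"
      using \<alpha>2 by Groebner_Basis.algebra
    have 2: "\<alpha> * w = - w - 3 * (A * \<theta>) - 3 * (B * 1)"
      using w\<alpha> by Groebner_Basis.algebra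
    have "\<alpha> * \<alpha> \<in> T" "\<alpha> * w \<in> T" unfolding 1 2 by (intro T_rules)+
    then have "\<alpha> * \<alpha> \<in> T" "\<alpha> * w \<in> T" "\<theta> * (\<alpha> * \<alpha>) \<in> T" "\<theta> * (\<alpha> * w) \<in> T" by (auto intro: \<theta>T)
    then show "\<alpha> * e i \<in> T" if "i < 6" for i
      using that base by (auto simp: less_6_iff mult_ac)
  qed
  have wT: "w * y \<in> T" if "y \<in> T" for y
    using \<theta>T[OF \<theta>T[OF that]] that T_intros(5)[of "\<theta> * (\<theta> * y)" y]
    unfolding w_def by (simp add: power2_eq_square algebra_simps)
  have e_mult: "e i * y \<in> T" if "i < 6" "y \<in> T" for i y
    using that \<theta>T \<alpha>T wT by (auto simp: less_6_iff mult.assoc)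
  have \<alpha>K: "w \<in> rat_adjoin \<theta>" "\<alpha> \<in> rat_adjoin \<theta>"
    unfolding \<alpha>_def w_def
    by (intro rat_adjoin_divide subring_set_closed[OF subring_set_rat_adjoin] rat_adjoin_self)+
  have T: "subring_set T"
    unfolding subring_set_def
  proof (intro conjI ballI)
    show "x * y \<in> T" if "x \<in> T" "y \<in> T" for x y
      using int_span_mult_left[of 6 y e 6 e x] e_mult that unfolding T_def by (simp add: mult.commute)
  qed (auto intro: T_intros base)
  note T_closed = subring_set_closed[OF T]
  define N where "N = ideal_gen T (of_int 3) w"
  note N_closed = ideal_gen_add[OF T, of _ "of_int 3" w, folded N_def]
    ideal_gen_diff[OF T, of _ "of_int 3" w, folded N_def]
    ideal_gen_mult[OF T, of _ "of_int 3" w, folded N_def]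
  note three = ideal_gen_left[OF T, of _ "of_int 3" w, folded N_def, simplified]
  note wN = ideal_gen_right[OF T, of _ w "of_int 3", folded N_def]
  have "\<theta> ^ 3 - \<theta> = w * \<theta>" using \<theta>2 by Groebner_Basis.algebra
  then have \<theta>3: "\<theta> ^ 3 - \<theta> \<in> N" using wN base by simp
  have \<alpha>3: "\<alpha> ^ 3 - \<alpha> \<in> N"
  proof -
    define R where "R = A * \<theta> + B * 1"
    have "\<alpha> ^ 3 - \<alpha> = 3 * (R - \<alpha> * R) + w * (R - \<alpha> * R)"
      using \<alpha>2 unfolding R_def by Groebner_Basis.algebra
    moreover have "R \<in> T" unfolding R_def by (intro T_rules)
    then have "R - \<alpha> * R \<in> T" by (intro T_rules subring_set_mult[OF T])
    ultimately show ?thesis by (metis N_closed(1) three wN)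
  qed
  \<comment> \<open>The value of \<open>w'\<close> is w^2 / 3; the basis members w and w \<theta>
    lie in N, which leaves d = 4.\<close>
  show ?thesis
  proof (rule not_monogenic_frobenius[where F = F and e = e and n = 6 and T = T and N = N and p = 3
        and w = w and w' = "\<alpha> - w" and q = 3 and d = 4 and G = "{\<theta>, \<alpha>}"])
    show "e i \<in> rat_adjoin \<theta>" if "i < 6" for i
      using that subring_set_closed[OF subring_set_rat_adjoin[of \<theta>]] rat_adjoin_self \<alpha>K
      by (auto simp: less_6_iff)
    show "k i = 0" if "(\<Sum>i<6. of_int (k i) * e i) = 0" and "i < 6" for k i
    proof -
      have "3 * (of_int (k 0) + of_int (k 1) * \<theta> + of_int (k 2) * \<alpha> + of_int (k 3) * (\<alpha> * \<theta>)
          + of_int (k 4) * w + of_int (k 5) * (w * \<theta>)) = 0"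
        using that(1) by (simp add: sum_less_6)
      then have "of_int (3 * k 0 - 3 * k 4 - 2 * k 2) + of_int (3 * k 1 - 3 * k 5 - 2 * k 3) * \<theta>
          + of_int (3 * k 4 + k 2) * \<theta> ^ 2 + of_int (3 * k 5 + k 3) * \<theta> ^ 3
          + of_int (k 2) * \<theta> ^ 4 + of_int (k 3) * \<theta> ^ 5 = 0"
        using \<theta>2 w2 unfolding of_int_diff of_int_mult of_int_add of_int_numeral
        by Groebner_Basis.algebra
      from powers_independent[OF irr root _ this] have
        "3 * k 0 - 3 * k 4 - 2 * k 2 = 0 \<and> 3 * k 1 - 3 * k 5 - 2 * k 3 = 0 \<and> 3 * k 4 + k 2 = 0
          \<and> 3 * k 5 + k 3 = 0 \<and> k 2 = 0 \<and> k 3 = 0"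
        by (simp add: F)
      then show ?thesis using \<open>i < 6\<close> by (auto simp: less_6_iff)
    qed
    show "e i \<in> S" if "subring_set S" "{\<theta>, \<alpha>} \<subseteq> S" "i < 6" for S i
      using that(2,3) subring_set_closed[OF that(1)] by (auto simp: less_6_iff w_def)
    show "w * e i \<in> int_span 6 (\<lambda>i. if i < 4 then of_int 3 * e i else e i)" (is "_ \<in> ?S")
      if "i < 6" for i
    proof -
      note S_base = int_span_base[of _ 6 "\<lambda>i. if i < 4 then of_int 3 * e i else e i"]
      have S: "3 * 1 \<in> ?S" "3 * \<theta> \<in> ?S" "3 * \<alpha> \<in> ?S" "3 * (\<alpha> * \<theta>) \<in> ?S" "w \<in> ?S" "w * \<theta> \<in> ?S"
        using S_base[of 0] S_base[of 1] S_base[of 2] S_base[of 3] S_base[of 4] S_base[of 5] by simp_all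
      have S_scale: "A * y \<in> ?S" "B * y \<in> ?S" if "y \<in> ?S" for y
        using that unfolding A_def B_def by (auto intro: int_span_scale)
      note S_rules = int_span_add int_span_diff int_span_uminus S_scale S
      have 1: "w * \<alpha> = - w - A * (3 * \<theta>) - B * (3 * 1)"
        using w\<alpha> by Groebner_Basis.algebra
      have 2: "w * (\<alpha> * \<theta>) = - (w * \<theta>) - A * (3 * 1) - A * (w + w + w) - B * (3 * \<theta>)"
        using w\<alpha> \<theta>2 by Groebner_Basis.algebra
      have 3: "w * w = 3 * \<alpha> - w - w - w"
        using w2 by Groebner_Basis.algebra
      have 4: "w * (w * \<theta>) = 3 * (\<alpha> * \<theta>) - w * \<theta> - w * \<theta> - w * \<theta>"
        using w2 by Groebner_Basis.algebra
      have "w * \<alpha> \<in> ?S" "w * (\<alpha> * \<theta>) \<in> ?S" "w * w \<in> ?S" "w * (w * \<theta>) \<in> ?S"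
        unfolding 1 2 3 4 by (intro S_rules)+
      then show ?thesis using that S by (auto simp: less_6_iff)
    qed
    show "\<exists>x\<in>T. w * y = of_int 3 * x" if y: "y \<in> T" "(\<alpha> - w) * y \<in> N" for y
    proof -
      \<comment> \<open>Modulo N the factor \<open>w'\<close> is \<alpha>. Since w \<alpha> = -w
        modulo 3 T, multiplying \<alpha> y = 3 x + w z by w turns the left side into -w y and the
        right side into a multiple of 3.\<close>
      have "(\<alpha> - w) * y + w * y \<in> N" using y wN N_closed by blast
      then have "\<alpha> * y \<in> N" by (simp add: algebra_simps)
      then obtain x z where xz: "\<alpha> * y = 3 * x + w * z" "x \<in> T" "z \<in> T"
        unfolding N_def ideal_gen_def by auto
      let ?r = "- (A * (\<theta> * y)) - B * y - w * x - (\<alpha> - w) * z"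
      have "w * y = 3 * ?r"
        using xz(1) w\<alpha> w2 by Groebner_Basis.algebra
      moreover have "?r \<in> T"
        by (intro T_rules subring_set_mult[OF T] y xz)
      ultimately show ?thesis unfolding of_int_numeral by blast
    qed
  qed (use irr root T_def N_def base e_mult \<theta>3 \<alpha>3 w2 T_closed(3) in auto)
qed

text \<open>The Newton polygon of \<open>F(x + 1)\<close> at 2 has a side from \<open>(0, 2k)\<close> to \<open>(2, 0)\<close>, where \<open>2\<^sup>k = 4 l\<close>;
  \<open>\<alpha>\<close> is the corresponding truncation of \<open>F(x + 1)\<close>, evaluated at \<open>u = \<theta> - 1\<close> and divided by \<open>2\<^sup>k\<close>.\<close>

lemma not_monogenic_shifted:
  fixes \<theta> :: complex and a b l m n :: int
  assumes F: "F = [:b, a, 0, 0, 0, 0, 1:]"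
    and irr: "Factorial_Ring.irreducible (map_poly rat_of_int F)"
    and root: "poly (of_int_poly F) \<theta> = 0"
    and ab: "a + 6 = 4 * l * m" "1 + a + b = 16 * l ^ 2 * n" "l \<noteq> 0" "odd m" "odd n"
  shows "\<not> monogenic (rat_adjoin \<theta>)"
proof -
  define L M H :: complex where "L = of_int l" and "M = of_int m" and "H = of_int n"
  have "L \<noteq> 0" using ab by (simp add: L_def)
  define u where "u = \<theta> - 1"
  have "\<theta> ^ 6 + of_int a * \<theta> + of_int b = 0"
    using root unfolding F
    by (simp add: of_int_hom.map_poly_pCons_hom eval_nat_numeral algebra_simps)
  moreover have "of_int a = 4 * L * M - 6" "of_int b = 16 * L ^ 2 * H - 1 - (4 * L * M - 6)"
  proof -
    have "a = 4 * l * m - 6" "b = 16 * l ^ 2 * n - 1 - (4 * l * m - 6)" using ab by linarith+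
    then show "of_int a = 4 * L * M - 6" "of_int b = 16 * L ^ 2 * H - 1 - (4 * L * M - 6)"
      by (simp_all add: L_def M_def H_def)
  qed
  moreover have \<theta>: "\<theta> = u + 1" by (simp add: u_def)
  ultimately have u6: "u ^ 6 + 6 * u ^ 5 + 15 * u ^ 4 + 20 * u ^ 3 + 15 * u ^ 2 + 4 * L * M * u
      + 16 * L ^ 2 * H = 0" by Groebner_Basis.algebra
  define \<alpha> where "\<alpha> = (u ^ 5 + 6 * u ^ 4 + 15 * u ^ 3 + 20 * u ^ 2 + 15 * u) / (4 * L)"
  have \<alpha>: "4 * L * \<alpha> = u ^ 5 + 6 * u ^ 4 + 15 * u ^ 3 + 20 * u ^ 2 + 15 * u"
    using \<open>L \<noteq> 0\<close> by (simp add: \<alpha>_def)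
  \<comment> \<open>Up to the factor 4, this is the equation of u with all terms of degree at least
    2 collected into 4 L u \<alpha>. Multiplying the definition of \<alpha> by \<alpha> and
    substituting for u \<alpha> then gives the quadratic equation of \<alpha>.\<close>
  have "L * (u * \<alpha> + M * u + 4 * L * H) = 0"
    using u6 \<alpha> by Groebner_Basis.algebra
  then have u\<alpha>: "u * \<alpha> + M * u + 4 * L * H = 0"
    using \<open>L \<noteq> 0\<close> by (simp only: mult_eq_0_iff) simp
  have "L * (\<alpha> ^ 2 + M * \<alpha> + H * (u ^ 4 + 6 * u ^ 3 + 15 * u ^ 2 + 20 * u + 15)) = 0"
    using u\<alpha> \<alpha> by Groebner_Basis.algebra
  then have \<alpha>2: "\<alpha> ^ 2 + M * \<alpha> + H * (u ^ 4 + 6 * u ^ 3 + 15 * u ^ 2 + 20 * u + 15) = 0"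
    using \<open>L \<noteq> 0\<close> by (simp only: mult_eq_0_iff) simp
  \<comment> \<open>F(x + 1) is the square of x^3 + x^2 + x modulo 2, so w is nilpotent modulo
    2.\<close>
  define w where "w = u ^ 3 + u ^ 2 + u"
  have w: "u ^ 3 = w - u ^ 2 - u" by (simp add: w_def)
  have u2w: "u ^ 2 * w = 4 * L * \<alpha> - 5 * u * w - 9 * w - 6 * u ^ 2 - 6 * u"
    using \<alpha> w by Groebner_Basis.algebra
  define e where "e i = [1, u, u ^ 2, \<alpha>, w, u * w] ! i" for i
  have e [simp]: "e 0 = 1" "e (Suc 0) = u" "e 2 = u ^ 2" "e 3 = \<alpha>" "e 4 = w" "e 5 = u * w"
    by (simp_all add: e_def)
  define T where "T = int_span 6 e"
  note T_intros = int_span_intros[where n = 6 and e = e, folded T_def]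
  have T_scale: "L * y \<in> T" "M * y \<in> T" "H * y \<in> T" if "y \<in> T" for y
    using that unfolding L_def M_def H_def T_def by (auto intro: int_span_scale)
  have base: "1 \<in> T" "u \<in> T" "u ^ 2 \<in> T" "\<alpha> \<in> T" "w \<in> T" "u * w \<in> T"
    using int_span_base[of _ 6 e] unfolding T_def by (force simp: less_6_iff)+
  note T_rules = T_intros(2-) T_scale base
  have uT: "u * y \<in> T" if "y \<in> T" for y
    using that unfolding T_def
  proof (rule int_span_mult_left[rotated], fold T_def)
    have 1: "u * u ^ 2 = w - u ^ 2 - u"
      using w by Groebner_Basis.algebra
    have 2: "u * \<alpha> = - (M * u) - 4 * (L * (H * 1))"
      using u\<alpha> by Groebner_Basis.algebra
    have 3: "u * (u * w) = 4 * (L * \<alpha>) - 5 * (u * w) - 9 * w - 6 * u ^ 2 - 6 * u"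
      using u2w by Groebner_Basis.algebra
    have "u * u ^ 2 \<in> T" "u * \<alpha> \<in> T" "u * (u * w) \<in> T" unfolding 1 2 3 by (intro T_rules)+
    then show "u * e i \<in> T" if "i < 6" for i
      using that base by (auto simp: less_6_iff power2_eq_square)
  qed
  have wT: "w * y \<in> T" if "y \<in> T" for y
  proof -
    have "w * y = u * (u * (u * y)) + u * (u * y) + u * y"
      by (simp add: w_def algebra_simps eval_nat_numeral)
    then show ?thesis using that by (auto intro!: T_intros(2) uT)
  qed
  have \<alpha>T: "\<alpha> * y \<in> T" if "y \<in> T" for y
    using that unfolding T_def
  proof (rule int_span_mult_left[rotated], fold T_def)
    have 1: "\<alpha> * \<alpha> = - (M * \<alpha>) - H * (u * w) - 5 * (H * w) - 9 * (H * u ^ 2) - 15 * (H * u) - 15 * (H * 1)"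
      using \<alpha>2 w by Groebner_Basis.algebra
    have "\<alpha> * \<alpha> \<in> T" unfolding 1 by (intro T_rules)
    moreover have "\<alpha> * u \<in> T" using uT[OF base(4)] by (simp add: mult.commute)
    moreover have "\<alpha> * u ^ 2 \<in> T"
      using uT[OF uT[OF base(4)]] by (simp add: power2_eq_square mult_ac)
    moreover have "\<alpha> * w \<in> T" "\<alpha> * (u * w) \<in> T"
      using wT[OF base(4)] uT[OF wT[OF base(4)]] by (simp_all add: mult_ac)
    ultimately show "\<alpha> * e i \<in> T" if "i < 6" for i
      using that base by (auto simp: less_6_iff)
  qed
  have e_mult: "e i * y \<in> T" if "i < 6" "y \<in> T" for i y
    using that uT \<alpha>T wT by (auto simp: less_6_iff mult.assoc power2_eq_square)
  have T: "subring_set T"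
    unfolding subring_set_def
  proof (intro conjI ballI)
    show "x * y \<in> T" if "x \<in> T" "y \<in> T" for x y
      using int_span_mult_left[of 6 y e 6 e x] e_mult that unfolding T_def by (simp add: mult.commute)
  qed (auto intro: T_intros base)
  note T_closed = subring_set_closed[OF T]
  define N where "N = ideal_gen T (of_int 2) w"
  note N_closed = ideal_gen_add[OF T, of _ "of_int 2" w, folded N_def]
    ideal_gen_diff[OF T, of _ "of_int 2" w, folded N_def]
    ideal_gen_mult[OF T, of _ "of_int 2" w, folded N_def]
  note two = ideal_gen_left[OF T, of _ "of_int 2" w, folded N_def, simplified]
  note wN = ideal_gen_right[OF T, of _ w "of_int 2", folded N_def]

  txt \<open>Modulo \<open>N\<close> the algebra is \<open>F\<^sub>4 \<times> F\<^sub>4\<close> with basis \<open>1, u, u\<^sup>2, \<alpha>\<close>, where \<open>u = (0, \<omega>)\<close> and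
    \<open>\<alpha> = (\<omega>, 1)\<close>.\<close>
  define q where "q c0 c1 c2 c3 = of_int c0 + of_int c1 * u + of_int c2 * u ^ 2 + of_int c3 * \<alpha>"
    for c0 c1 c2 c3 :: int
  have qT: "q c0 c1 c2 c3 \<in> T" for c0 c1 c2 c3
    unfolding q_def by (intro T_closed base)
  have q_even: "q c0 c1 c2 c3 \<in> N" if c: "even c0" "even c1" "even c2" "even c3" for c0 c1 c2 c3
  proof -
    obtain d0 d1 d2 d3 where "c0 = 2 * d0" "c1 = 2 * d1" "c2 = 2 * d2" "c3 = 2 * d3"
      using c by (elim evenE)
    then have "q c0 c1 c2 c3 = 2 * q d0 d1 d2 d3" by (simp add: q_def algebra_simps)
    then show ?thesis using two qT by simp
  qed
  have q_diff: "q c0 c1 c2 c3 - q d0 d1 d2 d3 = q (c0 - d0) (c1 - d1) (c2 - d2) (c3 - d3)"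
    for c0 c1 c2 c3 d0 d1 d2 d3 by (simp add: q_def algebra_simps)
  \<comment> \<open>The multiplication table modulo N: u^3 = u + u^2, u^4 = u, u \<alpha> = u, u^2
    \<alpha> = u^2 and \<alpha>^2 = 1 + u + u^2 + \<alpha>. \<open>?h\<close> is the exact product
    up to a multiple of w; oddness of m and n makes its coefficients agree with \<open>?g\<close>
    modulo 2.\<close>
  have q_mult: "q c0 c1 c2 c3 * q d0 d1 d2 d3
      - q (c0 * d0 + c3 * d3)
          (c0 * d1 + c1 * d0 + c1 * d2 + c2 * d1 + c2 * d2 + c1 * d3 + c3 * d1 + c3 * d3)
          (c0 * d2 + c2 * d0 + c1 * d1 + c1 * d2 + c2 * d1 + c2 * d3 + c3 * d2 + c3 * d3)
          (c0 * d3 + c3 * d0 + c3 * d3) \<in> N" (is "_ - ?g \<in> N")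
    for c0 c1 c2 c3 d0 d1 d2 d3
  proof -
    let ?h = "q (c0 * d0 - 4 * l * n * (c1 * d3 + c3 * d1) - 15 * n * c3 * d3)
      (c0 * d1 + c1 * d0 - (c1 * d2 + c2 * d1) + c2 * d2 - m * (c1 * d3 + c3 * d1)
        - 4 * l * n * (c2 * d3 + c3 * d2) - 15 * n * c3 * d3)
      (c0 * d2 + c2 * d0 + c1 * d1 - (c1 * d2 + c2 * d1) - m * (c2 * d3 + c3 * d2) - 9 * n * c3 * d3)
      (c0 * d3 + c3 * d0 - m * c3 * d3)"
    have u4: "u ^ 4 = u * w - w + u" using w by Groebner_Basis.algebra
    have u\<alpha>': "u * \<alpha> = - (M * u) - 4 * L * H" "u * (u * \<alpha>) = - (M * u ^ 2) - 4 * L * H * u"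
      using u\<alpha> by (Groebner_Basis.algebra, Groebner_Basis.algebra)
    have \<alpha>2': "\<alpha> * \<alpha> = - (M * \<alpha>) - H * (u * w + 5 * w + 9 * u ^ 2 + 15 * u + 15)"
      using \<alpha>2 w by Groebner_Basis.algebra
    have "q c0 c1 c2 c3 * q d0 d1 d2 d3 = of_int (c0 * d0) + of_int (c0 * d1 + c1 * d0) * u
        + of_int (c0 * d2 + c2 * d0 + c1 * d1) * u ^ 2 + of_int (c0 * d3 + c3 * d0) * \<alpha>
        + of_int (c1 * d2 + c2 * d1) * u ^ 3 + of_int (c2 * d2) * u ^ 4
        + of_int (c1 * d3 + c3 * d1) * (u * \<alpha>) + of_int (c2 * d3 + c3 * d2) * (u * (u * \<alpha>))
        + of_int (c3 * d3) * (\<alpha> * \<alpha>)"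
      by (simp add: q_def algebra_simps eval_nat_numeral)
    also have "\<dots> = ?h + w * (of_int (c1 * d2 + c2 * d1)
        + of_int (c2 * d2) * (u - 1) - of_int (n * c3 * d3) * (u + 5))"
      unfolding w u4 u\<alpha>' \<alpha>2' by (simp add: q_def L_def M_def H_def algebra_simps power2_eq_square)
    finally have "q c0 c1 c2 c3 * q d0 d1 d2 d3 = ?h + w * (of_int (c1 * d2 + c2 * d1)
        + of_int (c2 * d2) * (u - 1) - of_int (n * c3 * d3) * (u + 5))" .
    moreover have "of_int (c1 * d2 + c2 * d1) + of_int (c2 * d2) * (u - 1) - of_int (n * c3 * d3) * (u + 5) \<in> T"
      by (intro T_closed base)
    ultimately have "q c0 c1 c2 c3 * q d0 d1 d2 d3 - ?h \<in> N" using wN by simp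
    moreover have "?h - ?g \<in> N"
      unfolding q_diff by (rule q_even) (use ab in auto)
    ultimately have "(q c0 c1 c2 c3 * q d0 d1 d2 d3 - ?h) + (?h - ?g) \<in> N" by (rule N_closed(1))
    then show ?thesis by simp
  qed
  \<comment> \<open>Over F_2 the three cubics have in F_4 the root sets of all elements but 1, all
    elements but 0, and {0, 1}. A pair of elements of F_4 either avoids 1, avoids 0, or consists of
    0 and 1, so one cubic kills both components.\<close>
  have cubic: "y ^ 3 - y ^ 2 - y \<in> N \<or> y ^ 3 - 1 \<in> N \<or> y ^ 3 - y \<in> N" if "y \<in> T" for y
  proof -
    obtain k where k: "y = (\<Sum>i<6. of_int (k i) * e i)"
      using \<open>y \<in> T\<close> unfolding T_def int_span_def by blast
    define c0 c1 c2 c3 where "c0 = k 0" and "c1 = k 1" and "c2 = k 2" and "c3 = k 3"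
    note c_def = this
    let ?y = "q c0 c1 c2 c3" and ?s = "q (c0 + c3) (c2 + c3) (c1 + c3) c3"
    have "y - ?y = w * (of_int (k 4) + of_int (k 5) * u)"
      unfolding k sum_less_6 q_def c_def by (simp add: algebra_simps)
    then have y1: "y - ?y \<in> N" using wN T_closed base by simp
    \<comment> \<open>Squaring is additive modulo 2 and fixes the coefficients, so only the squares
      of the basis members matter.\<close>
    have y2: "y ^ 2 - ?s \<in> N"
    proof -
      let ?r = "q (c0 * c0 + c3 * c3)
          (c0 * c1 + c1 * c0 + c1 * c2 + c2 * c1 + c2 * c2 + c1 * c3 + c3 * c1 + c3 * c3)
          (c0 * c2 + c2 * c0 + c1 * c1 + c1 * c2 + c2 * c1 + c2 * c3 + c3 * c2 + c3 * c3)
          (c0 * c3 + c3 * c0 + c3 * c3)"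
      have "(y + ?y) * (y - ?y) \<in> N" by (rule N_closed(3)[OF y1 T_closed(6)[OF \<open>y \<in> T\<close> qT]])
      moreover have "?y * ?y - ?r \<in> N" by (rule q_mult)
      moreover have "?r - ?s \<in> N" unfolding q_diff by (rule q_even) auto
      ultimately have "(y + ?y) * (y - ?y) + (?y * ?y - ?r) + (?r - ?s) \<in> N"
        by (intro N_closed(1))
      then show ?thesis by (simp add: algebra_simps power2_eq_square)
    qed
    obtain t0 t1 t2 t3 where t:
      "t0 = c0 * (c0 + c3) + c3 * c3"
      "t1 = c0 * (c2 + c3) + c1 * (c0 + c3) + c1 * (c1 + c3) + c2 * (c2 + c3) + c2 * (c1 + c3)
        + c1 * c3 + c3 * (c2 + c3) + c3 * c3"
      "t2 = c0 * (c1 + c3) + c2 * (c0 + c3) + c1 * (c2 + c3) + c1 * (c1 + c3) + c2 * (c2 + c3)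
        + c2 * c3 + c3 * (c1 + c3) + c3 * c3"
      "t3 = c0 * c3 + c3 * (c0 + c3) + c3 * c3" by blast
    have y3: "y ^ 3 - q t0 t1 t2 t3 \<in> N"
    proof -
      have "y * (y ^ 2 - ?s) + ?s * (y - ?y) + (?y * ?s - q t0 t1 t2 t3) \<in> N"
        unfolding t
        by (rule N_closed(1)[OF N_closed(1)[OF N_closed(3)[OF y2 \<open>y \<in> T\<close>] N_closed(3)[OF y1 qT]] q_mult])
      moreover have "y * (y ^ 2 - ?s) + ?s * (y - ?y) + (?y * ?s - q t0 t1 t2 t3) = y ^ 3 - q t0 t1 t2 t3"
        by (simp add: algebra_simps eval_nat_numeral)
      ultimately show ?thesis by simp
    qed
    \<comment> \<open>The sixteen parity patterns of the coordinates are checked one by one.\<close>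
    consider "even (t0 - (c0 + c3) - c0)" "even (t1 - (c2 + c3) - c1)" "even (t2 - (c1 + c3) - c2)"
        "even (t3 - c3 - c3)"
      | "even (t0 - 1)" "even (t1 - 0)" "even (t2 - 0)" "even (t3 - 0)"
      | "even (t0 - c0)" "even (t1 - c1)" "even (t2 - c2)" "even (t3 - c3)"
      unfolding t
      by (cases "even c0"; cases "even c1"; cases "even c2"; cases "even c3") simp_all
    then show ?thesis
    proof cases
      case 1
      then have "q t0 t1 t2 t3 - ?s - ?y \<in> N" unfolding q_diff by (rule q_even)
      then have "(y ^ 3 - q t0 t1 t2 t3) - (y ^ 2 - ?s) - (y - ?y) + (q t0 t1 t2 t3 - ?s - ?y) \<in> N"
        by (rule N_closed(1)[OF N_closed(2)[OF N_closed(2)[OF y3 y2] y1]])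
      then show ?thesis by (simp add: algebra_simps)
    next
      case 2
      then have "q t0 t1 t2 t3 - q 1 0 0 0 \<in> N" unfolding q_diff by (rule q_even)
      then have "(y ^ 3 - q t0 t1 t2 t3) + (q t0 t1 t2 t3 - q 1 0 0 0) \<in> N"
        by (rule N_closed(1)[OF y3])
      then show ?thesis by (simp add: q_def)
    next
      case 3
      then have "q t0 t1 t2 t3 - ?y \<in> N" unfolding q_diff by (rule q_even)
      then have "(y ^ 3 - q t0 t1 t2 t3) - (y - ?y) + (q t0 t1 t2 t3 - ?y) \<in> N"
        by (rule N_closed(1)[OF N_closed(2)[OF y3 y1]])
      then show ?thesis by simp
    qed
  qed

  have uK: "u \<in> rat_adjoin \<theta>"
    unfolding u_def by (intro subring_set_closed[OF subring_set_rat_adjoin] rat_adjoin_self)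
  have LK: "L \<in> rat_adjoin \<theta>"
    unfolding L_def by (rule subring_set_of_int[OF subring_set_rat_adjoin])
  have wK: "w \<in> rat_adjoin \<theta>" "\<alpha> \<in> rat_adjoin \<theta>"
    unfolding \<alpha>_def w_def
    by (intro rat_adjoin_divide subring_set_closed[OF subring_set_rat_adjoin] uK LK)+

  \<comment> \<open>Z is (u^2 + u + 1) w / 2; as w = u (u^2 + u + 1), the quotient w^2 / 2 is u
    Z.\<close>
  define Z where "Z = 2 * L * \<alpha> - 2 * (u * w) - 4 * w - 3 * u ^ 2 - 3 * u"
  have ZT: "Z \<in> T"
    unfolding Z_def L_def by (intro T_closed base)
  have Z: "(u ^ 2 + u + 1) * w = 2 * Z"
    unfolding Z_def using u2w by Groebner_Basis.algebra
  show ?thesis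
  proof (rule not_monogenic_span[where F = F and e = e and n = 6 and T = T and N = N and p = 2
        and w = w and w' = "u * Z" and r = 3 and d = 4])
    show "e i \<in> rat_adjoin \<theta>" if "i < 6" for i
      using that subring_set_closed[OF subring_set_rat_adjoin[of \<theta>]] uK wK
      by (auto simp: less_6_iff)
    show "k i = 0" if "(\<Sum>i<6. of_int (k i) * e i) = 0" and "i < 6" for k i
    proof -
      \<comment> \<open>Coordinates in powers of u after multiplication by 4 L, the denominator of
        \<alpha>; the binomial expansion of powers of \<theta> - 1 then passes to powers of
        \<theta>.\<close>
      define g0 g1 g2 g3 g4 g5 where g: "g0 = 4 * l * k 0"
        "g1 = 4 * l * (k 1 + k 4) + 15 * k 3" "g2 = 4 * l * (k 2 + k 4 + k 5) + 20 * k 3"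
        "g3 = 4 * l * (k 4 + k 5) + 15 * k 3" "g4 = 4 * l * k 5 + 6 * k 3" "g5 = k 3"
      have "4 * L * (of_int (k 0) + of_int (k 1) * u + of_int (k 2) * u ^ 2 + of_int (k 3) * \<alpha>
          + of_int (k 4) * w + of_int (k 5) * (u * w)) = 0"
        using that(1) by (simp add: sum_less_6)
      then have "of_int g0 + of_int g1 * u + of_int g2 * u ^ 2 + of_int g3 * u ^ 3 + of_int g4 * u ^ 4
          + of_int g5 * u ^ 5 = 0"
        using \<alpha> w unfolding g of_int_diff of_int_mult of_int_add of_int_numeral L_def
        by Groebner_Basis.algebra
      then have "of_int (g0 - g1 + g2 - g3 + g4 - g5) + of_int (g1 - 2 * g2 + 3 * g3 - 4 * g4 + 5 * g5) * \<theta>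
          + of_int (g2 - 3 * g3 + 6 * g4 - 10 * g5) * \<theta> ^ 2 + of_int (g3 - 4 * g4 + 10 * g5) * \<theta> ^ 3
          + of_int (g4 - 5 * g5) * \<theta> ^ 4 + of_int g5 * \<theta> ^ 5 = 0"
        using \<theta> unfolding of_int_diff of_int_mult of_int_add of_int_numeral
        by Groebner_Basis.algebra
      from powers_independent[OF irr root _ this] have
        "g0 = 0" "g1 = 0" "g2 = 0" "g3 = 0" "g4 = 0" "g5 = 0"
        by (auto simp: F)
      then show ?thesis using \<open>i < 6\<close> \<open>l \<noteq> 0\<close> unfolding g by (auto simp: less_6_iff)
    qed
    show "w * e i \<in> int_span 6 (\<lambda>i. if i < 4 then of_int 2 * e i else e i)" (is "_ \<in> ?S")
      if "i < 6" for i
    proof -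
      note S_base = int_span_base[of _ 6 "\<lambda>i. if i < 4 then of_int 2 * e i else e i"]
      have S: "2 * 1 \<in> ?S" "2 * u \<in> ?S" "2 * u ^ 2 \<in> ?S" "2 * \<alpha> \<in> ?S" "w \<in> ?S" "u * w \<in> ?S"
        using S_base[of 0] S_base[of 1] S_base[of 2] S_base[of 3] S_base[of 4] S_base[of 5] by simp_all
      have S_scale: "L * y \<in> ?S" "M * y \<in> ?S" "H * y \<in> ?S" if "y \<in> ?S" for y
        using that unfolding L_def M_def H_def by (auto intro: int_span_scale)
      note S_rules = int_span_add int_span_diff int_span_uminus S_scale S
      have S_two: "2 * y \<in> ?S" if "y \<in> T" for y
        using that unfolding T_def
        by (rule int_span_mult_left[rotated]) (use S int_span_numeral in \<open>auto simp: less_6_iff\<close>)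
      have 1: "w * u ^ 2 = 2 * (2 * L * \<alpha> - 3 * u ^ 2 - 3 * u - 5 * w - 3 * (u * w)) + u * w + w"
        using u2w by Groebner_Basis.algebra
      have 2: "w * \<alpha> = 2 * (- 2 * L * H * (u ^ 2 + u + 1)) - M * w"
        using u\<alpha> unfolding w_def by Groebner_Basis.algebra
      have 3: "w * w = 2 * (u * Z)" "w * (u * w) = 2 * (u * (u * Z))"
        using Z unfolding w_def by (Groebner_Basis.algebra, Groebner_Basis.algebra)
      have t: "2 * L * \<alpha> - 3 * u ^ 2 - 3 * u - 5 * w - 3 * (u * w) \<in> T"
        "- 2 * L * H * (u ^ 2 + u + 1) \<in> T" "u * Z \<in> T" "u * (u * Z) \<in> T"
        unfolding L_def H_def by (intro T_closed base ZT)+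
      have "w * u ^ 2 \<in> ?S" "w * \<alpha> \<in> ?S" "w * w \<in> ?S" "w * (u * w) \<in> ?S"
        unfolding 1 2 3 by (intro S_rules S_two[OF t(1)] S_two[OF t(2)] S_two[OF t(3)] S_two[OF t(4)])+
      then show ?thesis using that S by (auto simp: less_6_iff mult.commute)
    qed
    show "\<exists>x\<in>T. w * y = of_int 2 * x" if y: "y \<in> T" "u * Z * y \<in> N" for y
    proof -
      \<comment> \<open>Chosen so that u Z = u + 2 X - 3 w: modulo N the factor \<open>w'\<close> is
        just u. From u y = 2 x + w z, multiplication by u^2 + u + 1 gives w y on the left and 2 Z z
        in place of w z.\<close>
      let ?X = "u + u * (L * \<alpha> - u * w - 2 * w)"
      have "?X \<in> T" by (intro T_closed base T_scale)
      have "u * y = u * Z * y - (2 * (?X * y) - w * (3 * y))"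
        unfolding Z_def using w by Groebner_Basis.algebra
      moreover have "u * Z * y - (2 * (?X * y) - w * (3 * y)) \<in> N"
        by (rule N_closed(2)[OF y(2) N_closed(2)[OF two wN]]) (intro T_closed y \<open>?X \<in> T\<close>)+
      ultimately obtain x z where xz: "u * y = 2 * x + w * z" "x \<in> T" "z \<in> T"
        unfolding N_def ideal_gen_def by auto
      have "w * y = 2 * ((u ^ 2 + u + 1) * x + Z * z)"
        using xz(1) Z w by Groebner_Basis.algebra
      moreover have "(u ^ 2 + u + 1) * x + Z * z \<in> T"
        by (intro T_closed base xz ZT)
      ultimately show ?thesis unfolding of_int_numeral by blast
    qed
    show "\<exists>g :: int poly. Polynomial.lead_coeff g = 1 \<and> Polynomial.degree g = 3 \<and>
        poly (of_int_poly g) y \<in> N" if "y \<in> T" for y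
      using cubic[OF that]
    proof (elim disjE)
      assume "y ^ 3 - y ^ 2 - y \<in> N"
      then show ?thesis
        by (intro exI[of _ "[:0, - 1, - 1, 1:]"]) (simp add: algebra_simps eval_nat_numeral)
    next
      assume "y ^ 3 - 1 \<in> N"
      then show ?thesis
        by (intro exI[of _ "[:- 1, 0, 0, 1:]"]) (simp add: algebra_simps eval_nat_numeral)
    next
      assume "y ^ 3 - y \<in> N"
      then show ?thesis
        by (intro exI[of _ "[:0, - 1, 0, 1:]"]) (simp add: algebra_simps eval_nat_numeral)
    qed
    show "y \<in> N" if y: "y \<in> T" "y ^ 2 \<in> N" for y
    proof -
      have y3: "y * y ^ 2 \<in> N" using y N_closed(3) by blast
      from cubic[OF y(1)] show ?thesis
      proof (elim disjE)
        assume "y ^ 3 - y ^ 2 - y \<in> N"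
        then have "y * y ^ 2 - y ^ 2 - (y ^ 3 - y ^ 2 - y) \<in> N" using y3 y(2) N_closed(2) by blast
        then show ?thesis by (simp add: eval_nat_numeral)
      next
        assume "y ^ 3 - 1 \<in> N"
        then have "y * (y * y ^ 2 - (y ^ 3 - 1)) \<in> N" using y3 y(1) N_closed(2,3) by blast
        then show ?thesis by (simp add: eval_nat_numeral)
      next
        assume "y ^ 3 - y \<in> N"
        then have "y * y ^ 2 - (y ^ 3 - y) \<in> N" using y3 N_closed(2) by blast
        then show ?thesis by (simp add: eval_nat_numeral)
      qed
    qed
    show "\<theta> \<in> T" unfolding \<theta> by (intro T_closed base)
    show "w ^ 2 = of_int 2 * (u * Z)"
      using Z unfolding w_def of_int_numeral by Groebner_Basis.algebra
  qed (use irr root T_def N_def base e_mult uT[OF ZT] in auto)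
qed

section \<open>The 2-adic valuations in condition (2) and the residues modulo 64\<close>

lemma nu2_eq_double:
  assumes "nu2 x = 2 * nu2 y" and "y \<noteq> 0"
  shows "\<exists>k m n. y = 2 ^ k * m \<and> x = 2 ^ (2 * k) * n \<and> odd m \<and> odd n"
proof -
  define k where "k = multiplicity 2 y"
  have x: "x \<noteq> 0 \<and> multiplicity 2 x = 2 * k"
    using assms by (auto simp: nu2_def k_def numeral_eq_enat split: if_splits)
  obtain m where "y = 2 ^ k * m" "odd m"
    using multiplicity_decompose'[of y 2] \<open>y \<noteq> 0\<close> unfolding k_def by auto
  moreover obtain n where "x = 2 ^ (2 * k) * n" "odd n"
    using multiplicity_decompose'[of x 2] x by auto
  ultimately show ?thesis by blast
qed

lemma nu2_power_mult_odd: "odd m \<Longrightarrow> nu2 (2 ^ n * m) = enat n"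
  using multiplicity_eqI[of 2 n "2 ^ n * m"] by (auto simp: nu2_def)

text \<open>The common shape of the four residue pairs: the valuations are exactly 2 and 4.\<close>

lemma condition_2_of_valuations:
  fixes a b p q :: int
  assumes "a + 6 = 4 * p" "1 + a + b = 16 * q" "odd p" "odd q"
  shows "[a = 2] (mod 4) \<and> [b = 1] (mod 4) \<and> nu2 (1 + a + b) = 2 * nu2 (a + 6)"
proof -
  have "a - 2 = 4 * (p - 2)" "b - 1 = 4 * (4 * q + 1 - p)"
    using assms(1,2) by simp_all
  then have "[a = 2] (mod 4)" "[b = 1] (mod 4)"
    unfolding cong_iff_dvd_diff by (metis dvd_triv_left)+
  moreover have "nu2 (a + 6) = enat 2" "nu2 (1 + a + b) = enat 4"
    unfolding assms(1,2)
    using nu2_power_mult_odd[OF \<open>odd p\<close>, of 2] nu2_power_mult_odd[OF \<open>odd q\<close>, of 4] by simp_all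
  moreover have "enat 4 = 2 * enat 2" by (simp add: numeral_eq_enat)
  ultimately show ?thesis by simp
qed

lemma residues_mod_64:
  fixes a b :: int
  assumes "([a = 6] (mod 64) \<and> [b = 9] (mod 64)) \<or> ([a = 14] (mod 64) \<and> [b = 1] (mod 64)) \<or>
    ([a = 22] (mod 64) \<and> [b = 25] (mod 64)) \<or> ([a = 30] (mod 64) \<and> [b = 17] (mod 64))"
  shows "[a = 2] (mod 4) \<and> [b = 1] (mod 4) \<and> nu2 (1 + a + b) = 2 * nu2 (a + 6)"
proof -
  define i j where "i = a div 64" and "j = b div 64"
  have a: "a = 64 * i + a mod 64" and b: "b = 64 * j + b mod 64"
    by (simp_all add: i_def j_def)
  consider "a mod 64 = 6" "b mod 64 = 9" | "a mod 64 = 14" "b mod 64 = 1"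
    | "a mod 64 = 22" "b mod 64 = 25" | "a mod 64 = 30" "b mod 64 = 17"
    using assms by (auto simp: cong_def)
  then show ?thesis
  proof cases
    case 1
    then show ?thesis using a b
      by (intro condition_2_of_valuations[of a "16 * i + 3" b "4 * i + 4 * j + 1"]) auto
  next
    case 2
    then show ?thesis using a b
      by (intro condition_2_of_valuations[of a "16 * i + 5" b "4 * i + 4 * j + 1"]) auto
  next
    case 3
    then show ?thesis using a b
      by (intro condition_2_of_valuations[of a "16 * i + 7" b "4 * i + 4 * j + 3"]) auto
  next
    case 4
    then show ?thesis using a b
      by (intro condition_2_of_valuations[of a "16 * i + 9" b "4 * i + 4 * j + 3"]) auto
  qed
qed

theorem theorem2p10:
  fixes a b :: int and F :: "int poly" and \<theta> :: complex and K :: "complex set"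
  assumes F: "F = [:b, a, 0, 0, 0, 0, 1:]"
    and irr: "Factorial_Ring.irreducible (map_poly rat_of_int F)"
    and root: "poly (map_poly complex_of_int F) \<theta> = 0"
    and K: "K = rat_adjoin \<theta>"
  shows "(([a = 0] (mod 8) \<and> [b = 7] (mod 8)) \<or>
          ([a = 2] (mod 4) \<and> [b = 1] (mod 4) \<and> nu2 (1 + a + b) = 2 * nu2 (a + 6)) \<or>
          ([a = 0] (mod 8) \<and> [b = 3] (mod 8)) \<or>
          ([a = 0] (mod 9) \<and> [b = -1] (mod 9))
            \<longrightarrow> \<not> monogenic K) \<and>
         (([a = 6] (mod 64) \<and> [b = 9] (mod 64)) \<or>
          ([a = 14] (mod 64) \<and> [b = 1] (mod 64)) \<or>
          ([a = 22] (mod 64) \<and> [b = 25] (mod 64)) \<or>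
          ([a = 30] (mod 64) \<and> [b = 17] (mod 64))
            \<longrightarrow> [a = 2] (mod 4) \<and> [b = 1] (mod 4) \<and> nu2 (1 + a + b) = 2 * nu2 (a + 6))"
proof (intro conjI impI)
  have not_8: "\<not> monogenic K" if ab: "[a = 0] (mod 8)" "[b = 4 * c - 1] (mod 8)" for c
  proof -
    obtain a' where "a = 8 * a'"
      using ab(1) unfolding cong_0_iff by (elim dvdE)
    moreover have "8 dvd b - (4 * c - 1)"
      using ab(2) by (simp add: cong_iff_dvd_diff add.commute)
    then obtain b' where "b - (4 * c - 1) = 8 * b'" by (elim dvdE)
    then have "b = 8 * b' + 4 * c - 1" by simp
    ultimately show ?thesis
      using not_monogenic_8[of F b' c a' \<theta>] F irr root K by simp
  qed
  have not_9: "\<not> monogenic K" if ab: "[a = 0] (mod 9)" "[b = - 1] (mod 9)"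
  proof -
    obtain a' where "a = 9 * a'"
      using ab(1) unfolding cong_0_iff by (elim dvdE)
    moreover have "9 dvd b - (- 1)"
      using ab(2) unfolding cong_iff_dvd_diff .
    then obtain b' where "b - (- 1) = 9 * b'" by (elim dvdE)
    then have "b = 9 * b' - 1" by simp
    ultimately show ?thesis
      using not_monogenic_9[of F b' a' \<theta>] F irr root K by simp
  qed
  have not_shifted: "\<not> monogenic K"
    if "[a = 2] (mod 4)" and nu: "nu2 (1 + a + b) = 2 * nu2 (a + 6)"
  proof -
    \<comment> \<open>Infinite valuations satisfy the equation too; they would force F = x^6 - 6 x +
      5, which has the root 1.\<close>
    have "a + 6 \<noteq> 0"
    proof
      assume "a + 6 = 0"
      then have "1 + a + b = 0"
        using nu by (auto simp: nu2_def numeral_eq_enat split: if_splits)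
      with \<open>a + 6 = 0\<close> have "a = - 6" "b = 5" by simp_all
      then have "poly (of_int_poly F) (1 :: complex) = 0"
        by (simp add: F of_int_hom.map_poly_pCons_hom)
      from degree_le_vanishing[OF irr this, of "[:- 1, 1:]"] show False
        by (simp add: F of_int_hom.map_poly_pCons_hom)
    qed
    then obtain k m n where kmn: "a + 6 = 2 ^ k * m" "1 + a + b = 2 ^ (2 * k) * n" "odd m" "odd n"
      using nu2_eq_double[OF nu] by blast
    \<comment> \<open>The congruence on a makes a + 6 divisible by 4, so k is at least 2 and 2^k can
      be written as 4 l.\<close>
    have "4 dvd 2 ^ k * m"
      unfolding kmn(1)[symmetric] using that(1) dvd_add[of 4 "a - 2" 8] by (simp add: cong_iff_dvd_diff add.commute)
    moreover have "coprime (4 :: int) m"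
      using \<open>odd m\<close> coprime_power_left_iff[of "2 :: int" 2 m] by simp
    ultimately have "(4 :: int) dvd 2 ^ k"
      by (simp add: coprime_dvd_mult_left_iff)
    moreover have "k = 0 \<or> k = 1 \<or> 2 \<le> k" by linarith
    ultimately have "2 \<le> k" by auto
    then obtain j where k: "k = 2 + j" using le_Suc_ex by blast
    show ?thesis
      unfolding K
      by (rule not_monogenic_shifted[OF F irr root, where l = "2 ^ j" and m = m and n = n])
        (use kmn in \<open>auto simp: k power_add power_mult power2_eq_square mult_ac\<close>)
  qed
  show "\<not> monogenic K"
    if "([a = 0] (mod 8) \<and> [b = 7] (mod 8)) \<or>
        ([a = 2] (mod 4) \<and> [b = 1] (mod 4) \<and> nu2 (1 + a + b) = 2 * nu2 (a + 6)) \<or>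
        ([a = 0] (mod 8) \<and> [b = 3] (mod 8)) \<or> ([a = 0] (mod 9) \<and> [b = - 1] (mod 9))"
    using that not_8[of 0] not_8[of 1] not_9 not_shifted by (auto simp: cong_def)
  assume "([a = 6] (mod 64) \<and> [b = 9] (mod 64)) \<or> ([a = 14] (mod 64) \<and> [b = 1] (mod 64)) \<or>
    ([a = 22] (mod 64) \<and> [b = 25] (mod 64)) \<or> ([a = 30] (mod 64) \<and> [b = 17] (mod 64))"
  from residues_mod_64[OF this] show "[a = 2] (mod 4)" "[b = 1] (mod 4)"
    "nu2 (1 + a + b) = 2 * nu2 (a + 6)" by blast+
qed

end
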